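(* Let $\delta$ be an associative algebra structure on $W$, $\mu$ an associative algebra structure on $M$, and let $\lambda$ be a fixed bimodule structure on $M$ compatible with $\mu$, i.e. $\lambda\in C^{1,1}$ is odd with $[\delta,\lambda]+\tfrac12[\lambda,\lambda]=0$ and $[\mu,\lambda]=0$. Then the extensions of $\delta$ by $\mu$ determined by $\lambda$ (i.e. those of the form $\delta+\mu+\lambda+\psi$), up to restricted equivalence, are classified by the cohomology classes $[\bar\psi]\in H^{0,2}_{\mu,\delta+\lambda}$: the map $\delta+\mu+\lambda+\psi\mapsto[\bar\psi]$ induces a bijection from restricted equivalence classes of such extensions to $H^{0,2}_{\mu,\delta+\lambda}$.
   Context: Work over a field $\mathbb K$ of characteristic different from 2 and 3. $M,W$ are $\mathbb Z_2$-graded vector spaces and $V=M\oplus W$ (parity-reversed convention: an ordinary ungraded algebra corresponds to a completely odd space). Let $C(V)=\operatorname{Hom}(T(V),V)$, $T(V)=\bigoplus_n V^{\otimes n}$. For $\varphi\in\operatorname{Hom}(V^{\otimes k},V)$ and $\chi\in\operatorname{Hom}(V^{\otimes l},V)$ put $$(\varphi\circ\chi)(v_1,\dots,v_{k+l-1})=\sum_i(-1)^{|\chi|(|v_1|+\dots+|v_{i-1}|)}\varphi(v_1,\dots,v_{i-1},\chi(v_i,\dots,v_{i+l-1}),\dots,v_{k+l-1}),$$ and $[\varphi,\chi]=\varphi\circ\chi-(-1)^{|\varphi||\chi|}\chi\circ\varphi$ (the graded Lie bracket of coderivations of $T(V)$). Maps defined on a summand of $T(V)$ are extended by zero. A codifferential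 is an odd $d$ with $[d,d]=0$; an odd $d\in\operatorname{Hom}(V^{\otimes2},V)$ is an associative algebra structure iff $[d,d]=0$. Let $T^{k,l}(M,W)\subseteq V^{\otimes(k+l)}$ be spanned by tensors of $k$ elements of $M$ and $l$ elements of $W$ in any order, $C^{k,l}=\operatorname{Hom}(T^{k,l}(M,W),M)$, and $C^k=\operatorname{Hom}(W^{\otimes k},W)$. Thus $\delta\in C^2$, $\mu\in C^{2,0}$ are odd with $[\delta,\delta]=[\mu,\mu]=0$. An extension of $\delta$ by $\mu$ is a codifferential $d=\delta+\mu+\lambda+\psi$ on $V$ with odd $\lambda\in C^{1,1}$, $\psi\in C^{0,2}$; equivalently $[\delta,\lambda]+\tfrac12[\lambda,\lambda]+[\mu,\psi]=0$, $[\mu,\lambda]=0$, $[\delta+\lambda,\psi]=0$. Two extensions $d,d'$ are (restrictedly) equivalent if $d'=f^*(d)=f^{-1}\circ d\circ(f\otimes f)$ for some $f=\exp(\beta)$, i.e. $f(m,w)=(m+\beta(w),w)$, with $\beta\in C^{0,1}=\operatorname{Hom}(W,M)$ even. For $\alpha\in C(V)$ put $D_\alpha=[\alpha,\cdot\,]$. $D_\mu:C^{k,l}\to C^{k+1,l}$ squares to zero; $H_\mu^{k,l}=\ker(D_\mu|_{C^{k,l}})/D_\mu(C^{k-1,l})$ (with $C^{-1,l}=0$), the class of $\varphi$ being $\bar\varphi$. Under the hypotheses on $\lambda$, $D_{\bar\delta+\bar\lambda}:H_\mu^{k,l}\to H_\mu^{k,l+1}$, $\bar\varphi\mapsto\overline{[\delta+\lambda,\varphi]}$,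 squares to zero, and $H_{\mu,\delta+\lambda}^{0,2}=\ker(D_{\bar\delta+\bar\lambda}:H_\mu^{0,2}\to H_\mu^{0,3})/D_{\bar\delta+\bar\lambda}(H_\mu^{0,1})$; the class of $\bar\psi$ is $[\bar\psi]$. Only classes of odd cochains are considered in $H^{0,2}_{\mu,\delta+\lambda}$ (automatic when $V$ is completely odd). *)

theory Defs
  imports "HOL-Library.Z2" "HOL-Library.Function_Algebras" "HOL-Library.Set_Algebras"
    "HOL-Analysis.Product_Vector"
begin

section \<open>Graded vector spaces\<close>

lemma UNIV_bit: "(UNIV :: bit set) = {0, 1}"
proof -
  have "x = 0 \<or> x = 1" for x :: bit by (cases x) auto
  then show ?thesis by blast
qed

instance bit :: finite
  by standard (simp add: UNIV_bit)

text \<open>Degrees live in \<^typ>\<open>bit\<close>, the field with two elements; \<open>part V p\<close> is the subspace of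
  elements of parity \<open>p\<close>.\<close>

record ('k, 'v) graded_space =
  sc :: "'k \<Rightarrow> 'v \<Rightarrow> 'v"
  part :: "bit \<Rightarrow> 'v set"

locale graded_vector_space = vector_space "sc V"
  for V :: "('k::field, 'v::ab_group_add) graded_space" +
  assumes subspace_part: "subspace (part V p)"
    and part_Int: "part V 0 \<inter> part V 1 = {0}"
    and part_sum: "\<exists>x\<in>part V 0. \<exists>y\<in>part V 1. v = x + y"

definition component :: "('k, 'v::ab_group_add) graded_space \<Rightarrow> bit \<Rightarrow> 'v \<Rightarrow> 'v" where
  "component V p v = (THE x. x \<in> part V p \<and> v - x \<in> part V (p + 1))"

definition direct_sum ::
    "('k::field, 'm::ab_group_add) graded_space \<Rightarrow> ('k, 'w::ab_group_add) graded_space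
      \<Rightarrow> ('k, 'm \<times> 'w) graded_space" (infixl \<open>\<oplus>\<^sub>g\<close> 65) where
  "M \<oplus>\<^sub>g W = \<lparr>sc = module_prod.scale (sc M) (sc W), part = (\<lambda>p. part M p \<times> part W p)\<rparr>"


section \<open>Cochains and the bracket\<close>

text \<open>By the universal property of the tensor powers, an element of
  \<open>C(V) = Hom(T(V), V)\<close>, i.e. a family of linear maps from \<open>V\<^sup>\<otimes>\<^sup>n\<close> to \<open>V\<close> for all \<open>n\<close>, is a
  function on lists that is linear in each entry.  Sums, differences and \<open>0\<close> of
  cochains are the pointwise ones.\<close>

type_synonym 'v cochain = "'v list \<Rightarrow> 'v"

definition cochains :: "('k::field, 'v::ab_group_add) graded_space \<Rightarrow> 'v cochain set" where
  "cochains V = {\<phi>. \<forall>vs. \<forall>i<length vs.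
      Vector_Spaces.linear (sc V) (sc V) (\<lambda>x. \<phi> (vs[i := x]))}"

definition scale_cochain :: "('k, 'v) graded_space \<Rightarrow> 'k \<Rightarrow> 'v cochain \<Rightarrow> 'v cochain" where
  "scale_cochain V c \<phi> = (\<lambda>vs. sc V c (\<phi> vs))"

definition has_parity :: "('k, 'v) graded_space \<Rightarrow> bit \<Rightarrow> 'v cochain \<Rightarrow> bool" where
  "has_parity V p \<phi> \<longleftrightarrow>
     (\<forall>ps vs. list_all2 (\<lambda>q v. v \<in> part V q) ps vs \<longrightarrow> \<phi> vs \<in> part V (p + sum_list ps))"

abbreviation "even_cochain V \<equiv> has_parity V 0"
abbreviation "odd_cochain V \<equiv> has_parity V 1"

text \<open>The homogeneous component of parity \<open>p\<close> of a cochain.\<close>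

definition hpart :: "('k, 'v::ab_group_add) graded_space \<Rightarrow> bit \<Rightarrow> 'v cochain \<Rightarrow> 'v cochain" where
  "hpart V p \<phi> vs = (\<Sum>ps | length ps = length vs.
      component V (p + sum_list ps) (\<phi> (map2 (component V) ps vs)))"

text \<open>\<open>koszul p x\<close> is \<open>(-1)\<^sup>p x\<close>.  The map \<open>twist V p\<close> is \<open>v \<mapsto> (-1)\<^bsup>p|v|\<^esup> v\<close> on homogeneous
  elements, extended linearly; it is used to write the sign rule for arguments that
  need not be homogeneous.\<close>

definition koszul :: "bit \<Rightarrow> 'a::ab_group_add \<Rightarrow> 'a" where
  "koszul p x = (if p = 0 then x else - x)"

definition twist :: "('k, 'v::ab_group_add) graded_space \<Rightarrow> bit \<Rightarrow> 'v \<Rightarrow> 'v" where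
  "twist V p v = (\<Sum>q\<in>UNIV. koszul (p * q) (component V q v))"

text \<open>The composition of coderivations, on all of \<open>C(V)\<close> at once: the insertion of the
  parity \<open>p\<close>, arity \<open>l\<close> component of \<open>\<chi>\<close> after \<open>i\<close> arguments, summed over \<open>i\<close>, \<open>l\<close>, \<open>p\<close>.
  The lemmas \<open>circ_homogeneous\<close> and \<open>bracket_homogeneous\<close> below recover the sign
  formulas for homogeneous cochains and arguments.\<close>

definition circ ::
    "('k, 'v::ab_group_add) graded_space \<Rightarrow> 'v cochain \<Rightarrow> 'v cochain \<Rightarrow> 'v cochain" where
  "circ V \<phi> \<chi> vs = (\<Sum>i\<le>length vs. \<Sum>l\<le>length vs - i. \<Sum>p\<in>UNIV.
      \<phi> (map (twist V p) (take i vs) @ [hpart V p \<chi> (take l (drop i vs))] @ drop (i + l) vs))"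

definition bracket ::
    "('k, 'v::ab_group_add) graded_space \<Rightarrow> 'v cochain \<Rightarrow> 'v cochain \<Rightarrow> 'v cochain" where
  "bracket V \<phi> \<chi> vs = circ V \<phi> \<chi> vs -
     (\<Sum>p\<in>UNIV. \<Sum>q\<in>UNIV. koszul (p * q) (circ V (hpart V q \<chi>) (hpart V p \<phi>) vs))"

definition codifferential :: "('k::field, 'v::ab_group_add) graded_space \<Rightarrow> 'v cochain \<Rightarrow> bool" where
  "codifferential V d \<longleftrightarrow> d \<in> cochains V \<and> odd_cochain V d \<and> bracket V d d = 0"


section \<open>Cochains on a direct sum\<close>

text \<open>A list over \<open>'m + 'w\<close> is a tensor of elements of \<open>M\<close> and of \<open>W\<close> in some order.
  \<open>hom_kl M W k l N\<close> is \<open>Hom(T\<^bsup>k,l\<^esup>(M,W), N)\<close>, extended by zero to \<open>T(V)\<close>.\<close>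

fun embed :: "'m::zero + 'w::zero \<Rightarrow> 'm \<times> 'w" where
  "embed (Inl m) = (m, 0)"
| "embed (Inr w) = (0, w)"

definition hom_kl ::
    "('k::field, 'm::ab_group_add) graded_space \<Rightarrow> ('k, 'w::ab_group_add) graded_space
      \<Rightarrow> nat \<Rightarrow> nat \<Rightarrow> ('m \<times> 'w) set \<Rightarrow> ('m \<times> 'w) cochain set" where
  "hom_kl M W k l N = {\<phi> \<in> cochains (M \<oplus>\<^sub>g W). range \<phi> \<subseteq> N \<and>
     (\<forall>xs. \<not> (length (filter isl xs) = k \<and> length (filter (Not \<circ> isl) xs) = l)
        \<longrightarrow> \<phi> (map embed xs) = 0)}"

text \<open>\<open>C\<^bsup>k,l\<^esup> = Hom(T\<^bsup>k,l\<^esup>(M,W), M)\<close> and \<open>C\<^sup>k = Hom(W\<^sup>\<otimes>\<^sup>k, W)\<close>.\<close>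

definition Ckl ::
    "('k::field, 'm::ab_group_add) graded_space \<Rightarrow> ('k, 'w::ab_group_add) graded_space
      \<Rightarrow> nat \<Rightarrow> nat \<Rightarrow> ('m \<times> 'w) cochain set" where
  "Ckl M W k l = hom_kl M W k l (UNIV \<times> {0})"

definition CW ::
    "('k::field, 'm::ab_group_add) graded_space \<Rightarrow> ('k, 'w::ab_group_add) graded_space
      \<Rightarrow> nat \<Rightarrow> ('m \<times> 'w) cochain set" where
  "CW M W k = hom_kl M W 0 k ({0} \<times> UNIV)"


section \<open>Extensions and restricted equivalence\<close>

definition extensions ::
    "('k::field, 'm::ab_group_add) graded_space \<Rightarrow> ('k, 'w::ab_group_add) graded_space
      \<Rightarrow> ('m \<times> 'w) cochain \<Rightarrow> ('m \<times> 'w) cochain \<Rightarrow> ('m \<times> 'w) cochain set" where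
  "extensions M W \<delta> \<mu> = {d. codifferential (M \<oplus>\<^sub>g W) d \<and>
     (\<exists>\<kappa>\<in>Ckl M W 1 1. \<exists>\<psi>\<in>Ckl M W 0 2.
        odd_cochain (M \<oplus>\<^sub>g W) \<kappa> \<and> odd_cochain (M \<oplus>\<^sub>g W) \<psi> \<and> d = \<delta> + \<mu> + \<kappa> + \<psi>)}"

definition extensions_by ::
    "('k::field, 'm::ab_group_add) graded_space \<Rightarrow> ('k, 'w::ab_group_add) graded_space
      \<Rightarrow> ('m \<times> 'w) cochain \<Rightarrow> ('m \<times> 'w) cochain \<Rightarrow> ('m \<times> 'w) cochain \<Rightarrow> ('m \<times> 'w) cochain set" where
  "extensions_by M W \<delta> \<mu> \<kappa> = {d \<in> extensions M W \<delta> \<mu>.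
     \<exists>\<psi>\<in>Ckl M W 0 2. odd_cochain (M \<oplus>\<^sub>g W) \<psi> \<and> d = \<delta> + \<mu> + \<kappa> + \<psi>}"

text \<open>\<open>\<beta> \<in> C\<^bsup>0,1\<^esup>\<close> is a cochain on \<open>V\<close>; as a map from \<open>W\<close> to \<open>M\<close> it is \<open>w \<mapsto> fst (\<beta> [(0, w)])\<close>.\<close>

definition exp_map :: "('m::ab_group_add \<times> 'w::ab_group_add) cochain \<Rightarrow> 'm \<times> 'w \<Rightarrow> 'm \<times> 'w" where
  "exp_map \<beta> = (\<lambda>(m, w). (m + fst (\<beta> [(0, w)]), w))"

definition pullback :: "('v \<Rightarrow> 'v) \<Rightarrow> 'v cochain \<Rightarrow> 'v cochain" where
  "pullback f d = (\<lambda>vs. inv f (d (map f vs)))"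

definition restricted_equiv ::
    "('k::field, 'm::ab_group_add) graded_space \<Rightarrow> ('k, 'w::ab_group_add) graded_space
      \<Rightarrow> ('m \<times> 'w) cochain \<Rightarrow> ('m \<times> 'w) cochain \<Rightarrow> ('m \<times> 'w) cochain rel" where
  "restricted_equiv M W \<delta> \<mu> = {(d, d'). d \<in> extensions M W \<delta> \<mu> \<and> d' \<in> extensions M W \<delta> \<mu> \<and>
     (\<exists>\<beta>\<in>Ckl M W 0 1. even_cochain (M \<oplus>\<^sub>g W) \<beta> \<and> d' = pullback (exp_map \<beta>) d)}"


section \<open>Cohomology\<close>

definition Z_mu ::
    "('k::field, 'm::ab_group_add) graded_space \<Rightarrow> ('k, 'w::ab_group_add) graded_space
      \<Rightarrow> ('m \<times> 'w) cochain \<Rightarrow> nat \<Rightarrow> nat \<Rightarrow> ('m \<times> 'w) cochain set" where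
  "Z_mu M W \<mu> k l = {\<phi> \<in> Ckl M W k l. bracket (M \<oplus>\<^sub>g W) \<mu> \<phi> = 0}"

definition B_mu ::
    "('k::field, 'm::ab_group_add) graded_space \<Rightarrow> ('k, 'w::ab_group_add) graded_space
      \<Rightarrow> ('m \<times> 'w) cochain \<Rightarrow> nat \<Rightarrow> nat \<Rightarrow> ('m \<times> 'w) cochain set" where
  "B_mu M W \<mu> k l = (case k of 0 \<Rightarrow> {0} | Suc k' \<Rightarrow> bracket (M \<oplus>\<^sub>g W) \<mu> ` Ckl M W k' l)"

definition rel_mu ::
    "('k::field, 'm::ab_group_add) graded_space \<Rightarrow> ('k, 'w::ab_group_add) graded_space
      \<Rightarrow> ('m \<times> 'w) cochain \<Rightarrow> nat \<Rightarrow> nat \<Rightarrow> ('m \<times> 'w) cochain rel" where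
  "rel_mu M W \<mu> k l = {(\<phi>, \<phi>'). \<phi> \<in> Z_mu M W \<mu> k l \<and> \<phi>' \<in> Z_mu M W \<mu> k l \<and> \<phi> - \<phi>' \<in> B_mu M W \<mu> k l}"

definition H_mu ::
    "('k::field, 'm::ab_group_add) graded_space \<Rightarrow> ('k, 'w::ab_group_add) graded_space
      \<Rightarrow> ('m \<times> 'w) cochain \<Rightarrow> nat \<Rightarrow> nat \<Rightarrow> ('m \<times> 'w) cochain set set" where
  "H_mu M W \<mu> k l = Z_mu M W \<mu> k l // rel_mu M W \<mu> k l"

definition class_mu ::
    "('k::field, 'm::ab_group_add) graded_space \<Rightarrow> ('k, 'w::ab_group_add) graded_space
      \<Rightarrow> ('m \<times> 'w) cochain \<Rightarrow> nat \<Rightarrow> nat \<Rightarrow> ('m \<times> 'w) cochain \<Rightarrow> ('m \<times> 'w) cochain set" where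
  "class_mu M W \<mu> k l \<phi> = rel_mu M W \<mu> k l `` {\<phi>}"

text \<open>The map induced by \<open>[\<alpha>, \<cdot>]\<close> from \<open>H\<^bsup>k,l\<^esup>\<close> to \<open>H\<^bsup>k,l+1\<^esup>\<close> with respect to \<open>D\<^sub>\<mu>\<close>, defined by union
  over representatives (all contribute the same class when the map is well defined).\<close>

definition D_bar ::
    "('k::field, 'm::ab_group_add) graded_space \<Rightarrow> ('k, 'w::ab_group_add) graded_space
      \<Rightarrow> ('m \<times> 'w) cochain \<Rightarrow> ('m \<times> 'w) cochain \<Rightarrow> nat \<Rightarrow> nat
      \<Rightarrow> ('m \<times> 'w) cochain set \<Rightarrow> ('m \<times> 'w) cochain set" where
  "D_bar M W \<mu> \<alpha> k l X = (\<Union>\<phi>\<in>X. class_mu M W \<mu> k (Suc l) (bracket (M \<oplus>\<^sub>g W) \<alpha> \<phi>))"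

definition Z_bar ::
    "('k::field, 'm::ab_group_add) graded_space \<Rightarrow> ('k, 'w::ab_group_add) graded_space
      \<Rightarrow> ('m \<times> 'w) cochain \<Rightarrow> ('m \<times> 'w) cochain \<Rightarrow> nat \<Rightarrow> nat \<Rightarrow> ('m \<times> 'w) cochain set set" where
  "Z_bar M W \<mu> \<alpha> k l = {X \<in> H_mu M W \<mu> k l. D_bar M W \<mu> \<alpha> k l X = class_mu M W \<mu> k (Suc l) 0}"

definition B_bar ::
    "('k::field, 'm::ab_group_add) graded_space \<Rightarrow> ('k, 'w::ab_group_add) graded_space
      \<Rightarrow> ('m \<times> 'w) cochain \<Rightarrow> ('m \<times> 'w) cochain \<Rightarrow> nat \<Rightarrow> nat \<Rightarrow> ('m \<times> 'w) cochain set set" where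
  "B_bar M W \<mu> \<alpha> k l = (case l of 0 \<Rightarrow> {class_mu M W \<mu> k 0 0}
     | Suc l' \<Rightarrow> D_bar M W \<mu> \<alpha> k l' ` H_mu M W \<mu> k l')"

text \<open>Classes are cosets, so the elementwise sum of sets in \<open>X = Y + U\<close> is the addition of the
  quotient space.\<close>

definition rel_bar ::
    "('k::field, 'm::ab_group_add) graded_space \<Rightarrow> ('k, 'w::ab_group_add) graded_space
      \<Rightarrow> ('m \<times> 'w) cochain \<Rightarrow> ('m \<times> 'w) cochain \<Rightarrow> nat \<Rightarrow> nat \<Rightarrow> ('m \<times> 'w) cochain set rel" where
  "rel_bar M W \<mu> \<alpha> k l = {(X, Y). X \<in> Z_bar M W \<mu> \<alpha> k l \<and> Y \<in> Z_bar M W \<mu> \<alpha> k l \<and>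
     (\<exists>U\<in>B_bar M W \<mu> \<alpha> k l. X = Y + U)}"

definition H_bar ::
    "('k::field, 'm::ab_group_add) graded_space \<Rightarrow> ('k, 'w::ab_group_add) graded_space
      \<Rightarrow> ('m \<times> 'w) cochain \<Rightarrow> ('m \<times> 'w) cochain \<Rightarrow> nat \<Rightarrow> nat \<Rightarrow> ('m \<times> 'w) cochain set set set" where
  "H_bar M W \<mu> \<alpha> k l = Z_bar M W \<mu> \<alpha> k l // rel_bar M W \<mu> \<alpha> k l"

definition class_bar ::
    "('k::field, 'm::ab_group_add) graded_space \<Rightarrow> ('k, 'w::ab_group_add) graded_space
      \<Rightarrow> ('m \<times> 'w) cochain \<Rightarrow> ('m \<times> 'w) cochain \<Rightarrow> nat \<Rightarrow> nat
      \<Rightarrow> ('m \<times> 'w) cochain set \<Rightarrow> ('m \<times> 'w) cochain set set" where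
  "class_bar M W \<mu> \<alpha> k l X = rel_bar M W \<mu> \<alpha> k l `` {X}"

text \<open>The classes \<open>[\<psi>\<bar>]\<close> that have an odd representative \<open>\<psi>\<close>.\<close>

definition H_bar_odd ::
    "('k::field, 'm::ab_group_add) graded_space \<Rightarrow> ('k, 'w::ab_group_add) graded_space
      \<Rightarrow> ('m \<times> 'w) cochain \<Rightarrow> ('m \<times> 'w) cochain \<Rightarrow> nat \<Rightarrow> nat \<Rightarrow> ('m \<times> 'w) cochain set set set" where
  "H_bar_odd M W \<mu> \<alpha> k l =
     {c \<in> H_bar M W \<mu> \<alpha> k l. \<exists>X\<in>c. \<exists>\<psi>\<in>X. odd_cochain (M \<oplus>\<^sub>g W) \<psi>}"


section \<open>The sign rule for homogeneous cochains\<close>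

context graded_vector_space
begin

lemma component_eqI:
  assumes "x \<in> part V p" "v - x \<in> part V (p + 1)"
  shows "component V p v = x"
  unfolding component_def
proof (rule the_equality)
  show "x \<in> part V p \<and> v - x \<in> part V (p + 1)" using assms by simp
next
  fix y assume y: "y \<in> part V p \<and> v - y \<in> part V (p + 1)"
  have "y - x \<in> part V p"
    using y assms subspace_diff[OF subspace_part] by blast
  moreover have "(v - x) - (v - y) \<in> part V (p + 1)"
    using y assms subspace_diff[OF subspace_part] by blast
  then have "y - x \<in> part V (p + 1)" by simp
  ultimately have "y - x \<in> part V 0 \<inter> part V 1" by (cases p) auto
  then show "y = x" using part_Int by simp
qed

lemma zero_in_part: "0 \<in> part V p"
  using subspace_0[OF subspace_part] .

lemma component_homogeneous:
  assumes "x \<in> part V q"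
  shows "component V p x = (if p = q then x else 0)"
proof (cases "p = q")
  case True
  then show ?thesis using assms zero_in_part by (auto intro: component_eqI)
next
  case False
  then have "q = p + 1" by (cases p; cases q) auto
  then show ?thesis using assms zero_in_part False by (auto intro: component_eqI)
qed

lemma component_in_part: "component V p v \<in> part V p"
  and component_sum: "component V 0 v + component V 1 v = v"
proof -
  obtain x y where xy: "x \<in> part V 0" "y \<in> part V 1" "v = x + y" using part_sum by blast
  then have c: "component V 0 v = x" "component V 1 v = y"
    by (auto intro: component_eqI)
  show "component V p v \<in> part V p" using c xy by (cases p) auto
  show "component V 0 v + component V 1 v = v" using c xy by simp
qed

lemma sum_component: "(\<Sum>p\<in>UNIV. component V p v) = v"
  using component_sum by (simp add: UNIV_bit)

lemma twist_homogeneous: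
  assumes "x \<in> part V q"
  shows "twist V p x = koszul (p * q) x"
  using assms by (cases q) (simp_all add: twist_def UNIV_bit component_homogeneous koszul_def)

lemma cochain_linear:
  assumes "\<phi> \<in> cochains V"
  shows "Vector_Spaces.linear (sc V) (sc V) (\<lambda>x. \<phi> (us @ x # vs))"
proof -
  have "length us < length (us @ 0 # vs)" by simp
  then have "Vector_Spaces.linear (sc V) (sc V) (\<lambda>x. \<phi> ((us @ 0 # vs)[length us := x]))"
    using assms unfolding cochains_def by blast
  then show ?thesis by simp
qed

lemma cochain_hom:
  assumes "\<phi> \<in> cochains V"
  shows "module_hom (sc V) (sc V) (\<lambda>x. \<phi> (us @ x # vs))"
  using cochain_linear[OF assms] by (simp add: module_hom_eq_linear)

lemma cochain_zero: "\<phi> \<in> cochains V \<Longrightarrow> \<phi> (us @ 0 # vs) = 0"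
  using module_hom.zero[OF cochain_hom] by blast

lemma cochain_koszul: "\<phi> \<in> cochains V \<Longrightarrow> \<phi> (us @ koszul p x # vs) = koszul p (\<phi> (us @ x # vs))"
  using module_hom.neg[OF cochain_hom] by (simp add: koszul_def)

lemma lists_bit_Suc:
  "{ps :: bit list. length ps = Suc n} = (\<lambda>(p, ps). p # ps) ` (UNIV \<times> {ps. length ps = n})"
  by (auto simp: image_iff length_Suc_conv)

lemma sum_lists_Suc:
  "(\<Sum>ps | length ps = Suc n. f ps) = (\<Sum>p\<in>UNIV. \<Sum>ps | length ps = n. f ((p :: bit) # ps))"
proof -
  have "inj_on (\<lambda>(p :: bit, ps). p # ps) A" for A by (auto simp: inj_on_def)
  then show ?thesis
    unfolding lists_bit_Suc sum.cartesian_product by (subst sum.reindex) (auto simp: case_prod_unfold)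
qed

lemma cochain_expand_aux:
  assumes "\<phi> \<in> cochains V"
  shows "\<phi> (us @ vs) = (\<Sum>ps | length ps = length vs. \<phi> (us @ map2 (component V) ps vs))"
proof (induction vs arbitrary: us)
  case Nil
  then show ?case by simp
next
  case (Cons v vs)
  have "\<phi> (us @ v # vs) = \<phi> (us @ (\<Sum>p\<in>UNIV. component V p v) # vs)"
    by (simp add: sum_component)
  also have "\<dots> = (\<Sum>p\<in>UNIV. \<phi> (us @ component V p v # vs))"
    by (rule module_hom.sum[OF cochain_hom[OF assms]])
  also have "\<dots> = (\<Sum>p\<in>UNIV. \<Sum>ps | length ps = length vs.
      \<phi> (us @ component V p v # map2 (component V) ps vs))"
    using Cons.IH[of "us @ [component V _ v]"] by simp
  finally show ?case by (simp add: sum_lists_Suc)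
qed

lemmas cochain_expand = cochain_expand_aux[where us = "[]", simplified]

lemma list_all2_component:
  "length ps = length vs \<Longrightarrow> list_all2 (\<lambda>q v. v \<in> part V q) ps (map2 (component V) ps vs)"
  by (induction ps vs rule: list_induct2) (auto simp: component_in_part)

lemma hpart_homogeneous:
  assumes "\<phi> \<in> cochains V" "has_parity V q \<phi>"
  shows "hpart V p \<phi> = (if p = q then \<phi> else 0)"
proof
  fix vs
  have "component V (p + sum_list ps) (\<phi> (map2 (component V) ps vs)) =
      (if p = q then \<phi> (map2 (component V) ps vs) else 0)" if "length ps = length vs" for ps
  proof -
    have m: "\<phi> (map2 (component V) ps vs) \<in> part V (q + sum_list ps)"
      using assms(2) list_all2_component[OF that] unfolding has_parity_def by blast
    show ?thesis by (simp only: component_homogeneous[OF m] add_right_cancel)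
  qed
  then have "hpart V p \<phi> vs =
      (\<Sum>ps | length ps = length vs. if p = q then \<phi> (map2 (component V) ps vs) else 0)"
    unfolding hpart_def by (intro sum.cong) auto
  then show "hpart V p \<phi> vs = (if p = q then \<phi> else 0) vs"
    using cochain_expand[OF assms(1), of vs] by (cases "p = q") simp_all
qed

lemma koszul_koszul: "koszul p (koszul q x) = koszul (p + q) x"
  by (cases p; cases q) (simp_all add: koszul_def)

lemma cochain_twist:
  assumes "\<phi> \<in> cochains V" "list_all2 (\<lambda>q v. v \<in> part V q) ps us"
  shows "\<phi> (ts @ map (twist V q) us @ vs) = koszul (q * sum_list ps) (\<phi> (ts @ us @ vs))"
  using assms(2)
proof (induction ps us arbitrary: ts rule: list_all2_induct)
  case Nil
  then show ?case by (simp add: koszul_def)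
next
  case (Cons p ps u us)
  have "\<phi> (ts @ map (twist V q) (u # us) @ vs) =
      \<phi> (ts @ koszul (q * p) u # map (twist V q) us @ vs)"
    using twist_homogeneous[OF Cons(1)] by simp
  also have "\<dots> = koszul (q * p) (\<phi> (ts @ u # map (twist V q) us @ vs))"
    by (rule cochain_koszul[OF assms(1)])
  also have "\<dots> = koszul (q * p) (koszul (q * sum_list ps) (\<phi> (ts @ u # us @ vs)))"
    using Cons.IH[of "ts @ [u]"] by simp
  finally show ?case by (simp only: koszul_koszul distrib_left sum_list.Cons append_Cons)
qed

lemma circ_homogeneous_sum:
  assumes "\<phi> \<in> cochains V" "\<chi> \<in> cochains V" "has_parity V q \<chi>"
    and "list_all2 (\<lambda>p v. v \<in> part V p) ps vs"
  shows "circ V \<phi> \<chi> vs = (\<Sum>i\<le>length vs. \<Sum>l\<le>length vs - i.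
      koszul (q * sum_list (take i ps))
        (\<phi> (take i vs @ [\<chi> (take l (drop i vs))] @ drop (i + l) vs)))"
proof -
  have key: "(\<Sum>p\<in>UNIV. \<phi> (map (twist V p) (take i vs) @ [hpart V p \<chi> us] @ ws)) =
      koszul (q * sum_list (take i ps)) (\<phi> (take i vs @ [\<chi> us] @ ws))" for i us ws
  proof -
    have "(\<Sum>p\<in>UNIV. \<phi> (map (twist V p) (take i vs) @ [hpart V p \<chi> us] @ ws)) =
        (\<Sum>p\<in>UNIV. if p = q then \<phi> (map (twist V q) (take i vs) @ [\<chi> us] @ ws) else 0)"
      using assms by (intro sum.cong) (auto simp: hpart_homogeneous cochain_zero)
    also have "\<dots> = \<phi> (map (twist V q) (take i vs) @ [\<chi> us] @ ws)" by simp
    also have "\<dots> = koszul (q * sum_list (take i ps)) (\<phi> (take i vs @ [\<chi> us] @ ws))"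
      using cochain_twist[OF assms(1) list_all2_takeI[OF assms(4), of i], where ts = "[]"] by simp
    finally show ?thesis .
  qed
  show ?thesis by (simp only: circ_def key)
qed

lemma circ_homogeneous:
  assumes "\<phi> \<in> cochains V" "\<chi> \<in> cochains V" "has_parity V q \<chi>"
    and "list_all2 (\<lambda>p v. v \<in> part V p) ps vs"
    and arity: "\<And>us. length us \<noteq> l \<Longrightarrow> \<chi> us = 0" and len: "length vs + 1 = k + l" and "k > 0"
  shows "circ V \<phi> \<chi> vs = (\<Sum>i<k. koszul (q * sum_list (take i ps))
      (\<phi> (take i vs @ [\<chi> (take l (drop i vs))] @ drop (i + l) vs)))"
proof -
  let ?t = "\<lambda>i l. koszul (q * sum_list (take i ps))
      (\<phi> (take i vs @ [\<chi> (take l (drop i vs))] @ drop (i + l) vs))"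
  have "(\<Sum>j\<le>length vs - i. ?t i j) = (if i < k then ?t i l else 0)" if "i \<le> length vs" for i
  proof -
    have z: "?t i j = (if j = l then ?t i l else 0)" if "j \<le> length vs - i" for j
    proof (cases "j = l")
      case False
      then have "\<chi> (take j (drop i vs)) = 0" using that by (intro arity) simp
      then show ?thesis using False by (simp add: cochain_zero[OF assms(1)] koszul_def)
    qed simp
    have "(\<Sum>j\<le>length vs - i. ?t i j) = (\<Sum>j\<le>length vs - i. if j = l then ?t i l else 0)"
      by (rule sum.cong) (simp_all only: z atMost_iff)
    also have "\<dots> = (if i < k then ?t i l else 0)"
      using that len \<open>k > 0\<close> by (auto simp: sum.delta)
    finally show ?thesis .
  qed
  then have "circ V \<phi> \<chi> vs = (\<Sum>i\<le>length vs. if i < k then ?t i l else 0)"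
    unfolding circ_homogeneous_sum[OF assms(1-4)] by (intro sum.cong) simp_all
  also have "\<dots> = (\<Sum>i\<in>{..length vs} \<inter> {i. i < k}. ?t i l)"
    by (subst sum.inter_restrict) (simp_all only: finite_atMost mem_Collect_eq)
  also have "\<dots> = (\<Sum>i\<in>{i. i < k}. ?t i l)"
  proof (rule sum.mono_neutral_left)
    show "finite {i. i < k}" by simp
    show "{..length vs} \<inter> {i. i < k} \<subseteq> {i. i < k}" by simp
    show "\<forall>i\<in>{i. i < k} - {..length vs} \<inter> {i. i < k}. ?t i l = 0"
    proof
      fix i assume "i \<in> {i. i < k} - {..length vs} \<inter> {i. i < k}"
      then have "length (take l (drop i vs)) \<noteq> l \<or> l = 0" and "i < k" "i > length vs" by auto
      then show "?t i l = 0" using len by auto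
    qed
  qed
  finally show ?thesis by (simp add: lessThan_def)
qed

lemma circ_zero_left: "circ V 0 \<chi> = 0"
  by (rule ext) (simp add: circ_def)

lemma circ_zero_right: "\<phi> \<in> cochains V \<Longrightarrow> circ V \<phi> 0 = 0"
proof (rule ext)
  fix vs assume "\<phi> \<in> cochains V"
  moreover have "component V p 0 = 0" for p
    using component_homogeneous[OF zero_in_part[of p], of p] by simp
  then have "hpart V p 0 = 0" for p by (intro ext) (simp add: hpart_def)
  ultimately show "circ V \<phi> 0 vs = (0 :: _ cochain) vs"
    by (simp add: circ_def cochain_zero)
qed

lemma bracket_homogeneous:
  assumes "\<phi> \<in> cochains V" "\<chi> \<in> cochains V" "has_parity V p \<phi>" "has_parity V q \<chi>"
  shows "bracket V \<phi> \<chi> = circ V \<phi> \<chi> - koszul (p * q) (circ V \<chi> \<phi>)"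
proof
  fix vs
  have "koszul (a * b) (circ V (hpart V b \<chi>) (hpart V a \<phi>) vs) =
      (if a = p then if b = q then koszul (p * q) (circ V \<chi> \<phi> vs) else 0 else 0)" for a b
    using assms by (simp add: hpart_homogeneous circ_zero_left circ_zero_right koszul_def)
  then have "bracket V \<phi> \<chi> vs = circ V \<phi> \<chi> vs - koszul (p * q) (circ V \<chi> \<phi> vs)"
    unfolding bracket_def by (cases p; cases q) (simp_all only: UNIV_bit, simp_all)
  then show "bracket V \<phi> \<chi> vs = (circ V \<phi> \<chi> - koszul (p * q) (circ V \<chi> \<phi>)) vs"
    by (simp add: koszul_def)
qed

end

lemma sc_direct_sum:
  assumes "graded_vector_space M" "graded_vector_space W"
  shows "sc (M \<oplus>\<^sub>g W) c (m, w) = (sc M c m, sc W c w)"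
proof -
  interpret M: graded_vector_space M by fact
  interpret W: graded_vector_space W by fact
  interpret module_prod "sc M" "sc W" by unfold_locales
  show ?thesis by (simp add: direct_sum_def scale_prod)
qed

lemma graded_vector_space_direct_sum:
  assumes "graded_vector_space M" "graded_vector_space W"
  shows "graded_vector_space (M \<oplus>\<^sub>g W)"
proof -
  interpret M: graded_vector_space M by fact
  interpret W: graded_vector_space W by fact
  interpret P: vector_space_prod "sc M" "sc W" by unfold_locales
  have sc: "sc (M \<oplus>\<^sub>g W) = P.scale" by (simp add: direct_sum_def)
  show ?thesis
  proof (intro graded_vector_space.intro graded_vector_space_axioms.intro)
    show "vector_space (sc (M \<oplus>\<^sub>g W))" unfolding sc by unfold_locales
    show "module.subspace (sc (M \<oplus>\<^sub>g W)) (part (M \<oplus>\<^sub>g W) p)" for p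
      unfolding sc by (simp add: direct_sum_def P.subspace_Times M.subspace_part W.subspace_part)
    show "part (M \<oplus>\<^sub>g W) 0 \<inter> part (M \<oplus>\<^sub>g W) 1 = {0}"
      using M.part_Int W.part_Int by (auto simp: direct_sum_def zero_prod_def)
    show "\<exists>x\<in>part (M \<oplus>\<^sub>g W) 0. \<exists>y\<in>part (M \<oplus>\<^sub>g W) 1. v = x + y" for v
    proof -
      obtain a b c d where "a \<in> part M 0" "b \<in> part M 1" "fst v = a + b"
        "c \<in> part W 0" "d \<in> part W 1" "snd v = c + d"
        using M.part_sum W.part_sum by metis
      then show ?thesis
        by (intro bexI[of _ "(a, c)"] bexI[of _ "(b, d)"]) (auto simp: direct_sum_def prod_eq_iff)
    qed
  qed
qed

end

theory Submission
  imports Defs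
begin

text \<open>By the relations on \<open>\<kappa>\<close> (the paper's \<open>\<lambda>\<close>), \<open>\<delta> + \<mu> + \<kappa> + \<psi>\<close> squares to
  \<open>[\<mu>, \<psi>] + [\<delta> + \<kappa>, \<psi>]\<close>, whose two summands have different numbers of arguments from \<open>M\<close>; so
  it is a codifferential iff both vanish.  Pulling it back along \<open>exp \<beta>\<close> adds \<open>[\<mu>, \<beta>]\<close>, which
  changes \<open>\<kappa>\<close>, then \<open>[\<delta> + \<kappa>, \<beta>]\<close>, which changes \<open>\<psi>\<close>, and \<open>\<mu> \<circ> (\<beta> \<otimes> \<beta>)\<close>, which vanishes when
  \<open>[\<mu>, \<beta>]\<close> does.  Hence equivalences that fix \<open>\<kappa>\<close> are exactly the \<open>exp \<beta>\<close> with \<open>\<beta>\<close> an even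
  \<open>D\<^sub>\<mu>\<close>-cocycle, and they move \<open>\<psi>\<close> by \<open>[\<delta> + \<kappa>, \<beta>]\<close>.  Since \<open>C\<^bsup>-1,l\<^esup> = 0\<close>, the classes in
  \<open>H\<^sub>\<mu>\<^bsup>0,l\<^esup>\<close> are singletons, and for odd \<open>\<psi>\<close> an arbitrary \<open>\<beta>\<close> may be replaced by its even part,
  because \<open>[\<phi>, \<cdot>]\<close> with \<open>\<phi>\<close> odd commutes with taking homogeneous parts up to a parity shift.\<close>


section \<open>Homogeneous parts and the bracket\<close>

context graded_vector_space
begin

section \<open>Subspaces of fixed parity; linearity of components and twists\<close>

lemma scale_in_part: "x \<in> part V p \<Longrightarrow> sc V c x \<in> part V p"
  using subspace_scale[OF subspace_part] .

lemma add_in_part: "x \<in> part V p \<Longrightarrow> y \<in> part V p \<Longrightarrow> x + y \<in> part V p"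
  using subspace_add[OF subspace_part] .

lemma diff_in_part: "x \<in> part V p \<Longrightarrow> y \<in> part V p \<Longrightarrow> x - y \<in> part V p"
  using subspace_diff[OF subspace_part] .

lemma sum_in_part: "(\<And>i. i \<in> I \<Longrightarrow> f i \<in> part V p) \<Longrightarrow> (\<Sum>i\<in>I. f i) \<in> part V p"
  using subspace_sum[OF subspace_part] .

lemma koszul_in_part: "x \<in> part V p \<Longrightarrow> koszul q x \<in> part V p"
  using subspace_neg[OF subspace_part] by (simp add: koszul_def)

lemma component_complement: "v - component V p v \<in> part V (p + 1)"
proof (cases p)
  case zero
  then have "v - component V p v = component V 1 v" using component_sum[of v] by (simp add: diff_eq_eq add.commute)
  then show ?thesis using component_in_part[of 1] zero by simp
next
  case one
  then have "v - component V p v = component V 0 v" using component_sum[of v] by (simp add: diff_eq_eq)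
  then show ?thesis using component_in_part[of 0] one by simp
qed

lemma component_linear: "Vector_Spaces.linear (sc V) (sc V) (component V p)"
  unfolding Vector_Spaces.linear_iff
proof (intro conjI allI vector_space_axioms)
  fix x y c
  have "(x + y) - (component V p x + component V p y) =
      (x - component V p x) + (y - component V p y)" by simp
  then show "component V p (x + y) = component V p x + component V p y"
    by (intro component_eqI) (simp_all only: add_in_part component_in_part component_complement)
  have "sc V c x - sc V c (component V p x) = sc V c (x - component V p x)"
    by (simp add: scale_right_diff_distrib)
  then show "component V p (sc V c x) = sc V c (component V p x)"
    by (intro component_eqI) (simp_all only: scale_in_part component_in_part component_complement)
qed

sublocale endo: vector_space_pair "sc V" "sc V"
  by unfold_locales

lemma component_add: "component V p (x + y) = component V p x + component V p y"
  using component_linear by (simp add: Vector_Spaces.linear_iff)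

lemma component_zero: "component V p 0 = 0"
  using component_add[of p 0 0] by simp

lemma linear_koszul: "Vector_Spaces.linear (sc V) (sc V) f \<Longrightarrow>
    Vector_Spaces.linear (sc V) (sc V) (\<lambda>x. koszul p (f x))"
  by (cases p) (simp_all add: koszul_def endo.linear_compose_neg)

lemma linear_sum: "(\<And>i. i \<in> I \<Longrightarrow> Vector_Spaces.linear (sc V) (sc V) (f i)) \<Longrightarrow>
    Vector_Spaces.linear (sc V) (sc V) (\<lambda>x. \<Sum>i\<in>I. f i x)"
  by (rule endo.linear_compose_sum) blast

lemma twist_linear: "Vector_Spaces.linear (sc V) (sc V) (twist V p)"
  unfolding twist_def by (intro linear_sum linear_koszul component_linear)

lemma twist_add: "twist V p (x + y) = twist V p x + twist V p y"
  using twist_linear by (simp add: Vector_Spaces.linear_iff)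

lemma twist_zero: "twist V p 0 = 0"
  using twist_add[of p 0 0] by simp

lemma twist_even: "twist V 0 v = v"
  by (simp add: twist_def koszul_def sum_component)

section \<open>Multilinearity and parity under sums and differences\<close>

lemma cochainsI: "(\<And>vs i. i < length vs \<Longrightarrow> Vector_Spaces.linear (sc V) (sc V) (\<lambda>x. \<phi> (vs[i := x]))) \<Longrightarrow>
    \<phi> \<in> cochains V"
  by (simp add: cochains_def)

lemma cochain_update: "\<phi> \<in> cochains V \<Longrightarrow> i < length vs \<Longrightarrow>
    Vector_Spaces.linear (sc V) (sc V) (\<lambda>x. \<phi> (vs[i := x]))"
  by (simp add: cochains_def)

lemma cochain_compose_update:
  assumes "\<phi> \<in> cochains V" "Vector_Spaces.linear (sc V) (sc V) g" "i < length vs"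
  shows "Vector_Spaces.linear (sc V) (sc V) (\<lambda>x. \<phi> (vs[i := g x]))"
  using Vector_Spaces.linear_compose[OF assms(2) cochain_update[OF assms(1,3)]] by (simp add: o_def)

lemma cochain_add: "\<phi> \<in> cochains V \<Longrightarrow> \<phi> (us @ (x + y) # vs) = \<phi> (us @ x # vs) + \<phi> (us @ y # vs)"
  using cochain_linear by (simp add: Vector_Spaces.linear_iff)

lemma zero_cochain: "0 \<in> cochains V"
  by (intro cochainsI) (simp add: endo.linear_zero)

lemma add_cochain: "\<phi> \<in> cochains V \<Longrightarrow> \<chi> \<in> cochains V \<Longrightarrow> \<phi> + \<chi> \<in> cochains V"
  by (intro cochainsI) (simp add: endo.linear_compose_add cochain_update)

lemma diff_cochain: "\<phi> \<in> cochains V \<Longrightarrow> \<chi> \<in> cochains V \<Longrightarrow> \<phi> - \<chi> \<in> cochains V"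
  by (intro cochainsI) (simp add: endo.linear_compose_sub cochain_update)

lemma has_parity_zero: "has_parity V p 0"
  by (simp add: has_parity_def zero_in_part)

lemma has_parity_add: "has_parity V p \<phi> \<Longrightarrow> has_parity V p \<chi> \<Longrightarrow> has_parity V p (\<phi> + \<chi>)"
  unfolding has_parity_def plus_fun_apply by (blast intro: add_in_part)

lemma has_parity_diff: "has_parity V p \<phi> \<Longrightarrow> has_parity V p \<chi> \<Longrightarrow> has_parity V p (\<phi> - \<chi>)"
  unfolding has_parity_def fun_diff_def by (blast intro: diff_in_part)

lemma koszul_cochain: "\<phi> \<in> cochains V \<Longrightarrow> koszul p \<phi> \<in> cochains V"
  using diff_cochain[OF zero_cochain] by (simp add: koszul_def)

lemma has_parity_koszul: "has_parity V p \<phi> \<Longrightarrow> has_parity V p (koszul q \<phi>)"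
  using has_parity_diff[OF has_parity_zero] by (simp add: koszul_def)

section \<open>Homogeneous parts of a cochain\<close>

lemma hpart_cochain:
  assumes "\<phi> \<in> cochains V"
  shows "hpart V p \<phi> \<in> cochains V"
proof (rule cochainsI)
  fix vs :: "'v list" and i assume i: "i < length vs"
  \<comment> \<open>Changing one argument changes one entry of each tuple of components, so every
    summand of \<open>hpart\<close> is a composite of linear maps in that argument.\<close>
  have up: "map2 (component V) ps (vs[i := x]) =
      (map2 (component V) ps vs)[i := component V (ps ! i) x]" if "length ps = length vs" for ps x
    using that i by (intro nth_equalityI) (auto simp: nth_list_update)
  have "Vector_Spaces.linear (sc V) (sc V) (\<lambda>x. \<Sum>ps | length ps = length vs.
      component V (p + sum_list ps) (\<phi> ((map2 (component V) ps vs)[i := component V (ps ! i) x])))"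
    using i by (intro linear_sum Vector_Spaces.linear_compose[OF _ component_linear, unfolded o_def]
        cochain_compose_update[OF assms] component_linear) auto
  also have "(\<lambda>x. \<Sum>ps | length ps = length vs.
      component V (p + sum_list ps) (\<phi> ((map2 (component V) ps vs)[i := component V (ps ! i) x])))
    = (\<lambda>x. hpart V p \<phi> (vs[i := x]))"
    by (auto simp: hpart_def up intro!: sum.cong ext)
  finally show "Vector_Spaces.linear (sc V) (sc V) (\<lambda>x. hpart V p \<phi> (vs[i := x]))" .
qed

text \<open>At a position where \<open>ps\<close> and \<open>qs\<close> differ, the component of a
  homogeneous entry is zero. A multilinear map therefore kills such a tuple.\<close>

lemma map2_component_homogeneous:
  assumes "list_all2 (\<lambda>q v. v \<in> part V q) qs vs"
    and "length ps = length vs" "ps \<noteq> qs"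
  shows "\<exists>us ws. map2 (component V) ps vs = us @ 0 # ws"
  using assms
proof (induction qs vs arbitrary: ps rule: list_all2_induct)
  case (Cons q qs v vs)
  then obtain p ps' where ps: "ps = p # ps'" by (cases ps) auto
  show ?case
  proof (cases "p = q")
    case True
    then have "length ps' = length vs" "ps' \<noteq> qs" using Cons.prems ps by auto
    then obtain us ws where "map2 (component V) ps' vs = us @ 0 # ws" using Cons.IH by blast
    then have "map2 (component V) ps (v # vs) = (component V p v # us) @ 0 # ws" by (simp add: ps)
    then show ?thesis by blast
  next
    case False
    then have "map2 (component V) ps (v # vs) = [] @ 0 # map2 (component V) ps' vs"
      using component_homogeneous[OF Cons(1)] by (simp add: ps)
    then show ?thesis by blast
  qed
qed simp

lemma map2_component_same:
  "list_all2 (\<lambda>q v. v \<in> part V q) qs vs \<Longrightarrow> map2 (component V) qs vs = vs"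
  by (induction qs vs rule: list_all2_induct) (auto simp: component_homogeneous)

text \<open>In the sum over all parity vectors only the vector \<open>qs\<close> of the arguments
  themselves survives.\<close>

lemma hpart_apply_homogeneous:
  assumes "\<phi> \<in> cochains V" "list_all2 (\<lambda>q v. v \<in> part V q) qs vs"
  shows "hpart V p \<phi> vs = component V (p + sum_list qs) (\<phi> vs)"
proof -
  have len: "length qs = length vs" using assms(2) by (rule list_all2_lengthD)
  have z: "component V (p + sum_list ps) (\<phi> (map2 (component V) ps vs)) =
      (if ps = qs then component V (p + sum_list qs) (\<phi> vs) else 0)"
    if len': "length ps = length vs" for ps
  proof (cases "ps = qs")
    case False
    then obtain us ws where "map2 (component V) ps vs = us @ 0 # ws"
      using map2_component_homogeneous[OF assms(2) len'] False by blast
    then show ?thesis using False by (simp add: cochain_zero[OF assms(1)] component_zero)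
  qed (simp add: map2_component_same[OF assms(2)])
  have fin: "finite {ps :: bit list. length ps = length vs}"
    using finite_lists_length_eq[of "UNIV :: bit set"] by simp
  have "hpart V p \<phi> vs = (\<Sum>ps | length ps = length vs.
      if ps = qs then component V (p + sum_list qs) (\<phi> vs) else 0)"
    unfolding hpart_def using z by (intro sum.cong) auto
  then show ?thesis using fin len by simp
qed

lemma hpart_parity: "\<phi> \<in> cochains V \<Longrightarrow> has_parity V p (hpart V p \<phi>)"
  by (simp add: has_parity_def hpart_apply_homogeneous component_in_part)

lemma hpart_add: "hpart V p (\<phi> + \<chi>) = hpart V p \<phi> + hpart V p \<chi>"
  by (rule ext) (simp add: hpart_def component_add sum.distrib)

lemma hpart_zero: "hpart V p 0 = 0"
  by (rule ext) (simp add: hpart_def component_zero)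

text \<open>Both sides expand multilinearly into their values on homogeneous components.\<close>

lemma cochain_eqI:
  assumes "\<phi> \<in> cochains V" "\<chi> \<in> cochains V"
    and "\<And>qs vs. list_all2 (\<lambda>q v. v \<in> part V q) qs vs \<Longrightarrow> \<phi> vs = \<chi> vs"
  shows "\<phi> = \<chi>"
proof
  fix vs
  show "\<phi> vs = \<chi> vs"
    unfolding cochain_expand[OF assms(1), of vs] cochain_expand[OF assms(2), of vs]
    by (intro sum.cong refl assms(3)[OF list_all2_component]) simp
qed

lemma hpart_sum:
  assumes "\<phi> \<in> cochains V"
  shows "hpart V 0 \<phi> + hpart V 1 \<phi> = \<phi>"
proof (rule cochain_eqI)
  fix qs vs assume h: "list_all2 (\<lambda>q v. v \<in> part V q) qs vs"
  have "component V q x + component V (1 + q) x = x" for q x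
    using component_sum[of x] by (cases q) (simp_all add: add.commute)
  then show "(hpart V 0 \<phi> + hpart V 1 \<phi>) vs = \<phi> vs"
    by (simp only: plus_fun_apply hpart_apply_homogeneous[OF assms h] add_0_left)
qed (simp_all add: assms add_cochain hpart_cochain)

section \<open>Additivity of composition and bracket\<close>

lemma circ_add_left: "circ V (\<phi> + \<phi>') \<chi> = circ V \<phi> \<chi> + circ V \<phi>' \<chi>"
  by (rule ext) (simp add: circ_def sum.distrib)

lemma circ_add_right: "\<phi> \<in> cochains V \<Longrightarrow> circ V \<phi> (\<chi> + \<chi>') = circ V \<phi> \<chi> + circ V \<phi> \<chi>'"
  by (rule ext) (simp add: circ_def hpart_add cochain_add sum.distrib)

lemma koszul_add: "koszul p (x + y) = koszul p x + koszul p y"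
  by (simp add: koszul_def)

text \<open>Multilinearity of \<open>\<phi>\<close> splits the term in which \<open>\<chi>\<close>
  is inserted; in the other term \<open>\<chi>\<close> is the outer cochain and
  \<open>circ_add_left\<close> applies.\<close>

lemma bracket_add_right:
  "\<phi> \<in> cochains V \<Longrightarrow> bracket V \<phi> (\<chi> + \<chi>') = bracket V \<phi> \<chi> + bracket V \<phi> \<chi>'"
  by (rule ext)
    (simp add: bracket_def circ_add_right circ_add_left hpart_add koszul_add sum.distrib)

lemma bracket_zero_right: "\<phi> \<in> cochains V \<Longrightarrow> bracket V \<phi> 0 = 0"
  using bracket_add_right[of \<phi> 0 0] by simp

lemma bracket_diff_right:
  assumes "\<phi> \<in> cochains V"
  shows "bracket V \<phi> (\<chi> - \<chi>') = bracket V \<phi> \<chi> - bracket V \<phi> \<chi>'"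
  using bracket_add_right[OF assms, of "\<chi> - \<chi>'" \<chi>'] by (simp add: eq_diff_eq)

lemma bracket_odd:
  assumes "\<phi> \<in> cochains V" "\<chi> \<in> cochains V" "odd_cochain V \<phi>" "odd_cochain V \<chi>"
  shows "bracket V \<phi> \<chi> = circ V \<phi> \<chi> + circ V \<chi> \<phi>"
  using bracket_homogeneous[OF assms] by (simp add: koszul_def)

lemma bracket_even:
  assumes "\<phi> \<in> cochains V" "\<chi> \<in> cochains V" "odd_cochain V \<phi>" "even_cochain V \<chi>"
  shows "bracket V \<phi> \<chi> = circ V \<phi> \<chi> - circ V \<chi> \<phi>"
  using bracket_homogeneous[OF assms] by (simp add: koszul_def)

section \<open>Parity and multilinearity of a composition\<close>

lemma circ_parity:
  assumes "\<phi> \<in> cochains V" "\<chi> \<in> cochains V" "has_parity V p \<phi>" "has_parity V q \<chi>"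
  shows "has_parity V (p + q) (circ V \<phi> \<chi>)"
  unfolding has_parity_def
proof (intro allI impI)
  fix ps vs assume h: "list_all2 (\<lambda>q v. v \<in> part V q) ps vs"
  have "\<phi> (take i vs @ [\<chi> (take l (drop i vs))] @ drop (i + l) vs) \<in> part V (p + q + sum_list ps)"
    for i l
  proof -
    have "\<chi> (take l (drop i vs)) \<in> part V (q + sum_list (take l (drop i ps)))"
      using assms(4) list_all2_takeI[OF list_all2_dropI[OF h]] unfolding has_parity_def by blast
    \<comment> \<open>The inserted block counts as one argument whose parity is the total parity of
      the block shifted by \<open>q\<close>; the overall sum of parities thus changes by
      \<open>q\<close> only.\<close>
    then have "list_all2 (\<lambda>q v. v \<in> part V q)
        (take i ps @ [q + sum_list (take l (drop i ps))] @ drop (i + l) ps)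
        (take i vs @ [\<chi> (take l (drop i vs))] @ drop (i + l) vs)"
      using h by (intro list_all2_appendI list_all2_takeI list_all2_dropI) simp_all
    then have "\<phi> (take i vs @ [\<chi> (take l (drop i vs))] @ drop (i + l) vs) \<in> part V
        (p + sum_list (take i ps @ [q + sum_list (take l (drop i ps))] @ drop (i + l) ps))"
      using assms(3) unfolding has_parity_def by blast
    also have "p + sum_list (take i ps @ [q + sum_list (take l (drop i ps))] @ drop (i + l) ps) =
        p + q + (sum_list (take i ps @ take l (drop i ps) @ drop l (drop i ps)))"
      by (simp only: sum_list_append sum_list.Cons sum_list.Nil drop_drop ac_simps add_0_right add_0_left)
    also have "take i ps @ take l (drop i ps) @ drop l (drop i ps) = ps"
      by (simp only: append_take_drop_id)
    finally show ?thesis .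
  qed
  then show "circ V \<phi> \<chi> vs \<in> part V (p + q + sum_list ps)"
    unfolding circ_homogeneous_sum[OF assms(1,2,4) h]
    by (intro sum_in_part koszul_in_part)
qed

text \<open>Keeps the twist in place of an explicit Koszul sign, so that the arguments may be
  inhomogeneous. This form is suited to checking linearity and to evaluating at arbitrary
  arguments.\<close>

lemma circ_parity_sum:
  assumes "\<phi> \<in> cochains V" "\<chi> \<in> cochains V" "has_parity V q \<chi>"
  shows "circ V \<phi> \<chi> vs = (\<Sum>i\<le>length vs. \<Sum>l\<le>length vs - i.
      \<phi> (map (twist V q) (take i vs) @ [\<chi> (take l (drop i vs))] @ drop (i + l) vs))"
proof -
  have "(\<Sum>p\<in>UNIV. \<phi> (map (twist V p) us @ [hpart V p \<chi> xs] @ ws)) =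
      \<phi> (map (twist V q) us @ [\<chi> xs] @ ws)" for us xs ws
  proof -
    have "(\<Sum>p\<in>UNIV. \<phi> (map (twist V p) us @ [hpart V p \<chi> xs] @ ws)) =
        (\<Sum>p\<in>UNIV. if p = q then \<phi> (map (twist V q) us @ [\<chi> xs] @ ws) else 0)"
      using assms by (intro sum.cong) (auto simp: hpart_homogeneous cochain_zero)
    then show ?thesis by simp
  qed
  then show ?thesis by (simp only: circ_def)
qed

lemma circ_cochain:
  assumes \<phi>: "\<phi> \<in> cochains V" and \<chi>: "\<chi> \<in> cochains V" and "has_parity V q \<chi>"
  shows "circ V \<phi> \<chi> \<in> cochains V"
proof (rule cochainsI)
  fix vs :: "'v list" and j assume j: "j < length vs"
  let ?t = "\<lambda>i l vs. \<phi> (map (twist V q) (take i vs) @ [\<chi> (take l (drop i vs))] @ drop (i + l) vs)"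
  have "Vector_Spaces.linear (sc V) (sc V) (\<lambda>x. ?t i l (vs[j := x]))"
    if il: "i \<le> length vs" "l \<le> length vs - i" for i l
  proof -
    let ?us = "map (twist V q) (take i vs) @ [\<chi> (take l (drop i vs))] @ drop (i + l) vs"
    \<comment> \<open>The varied argument is a twisted one in front of the block, one inside the
      inserted block, or one behind it.\<close>
    consider "j < i" | "i \<le> j" "j < i + l" | "i + l \<le> j" by linarith
    then show ?thesis
    proof cases
      case 1
      then have "map (twist V q) (take i (vs[j := x])) @ [\<chi> (take l (drop i (vs[j := x])))]
          @ drop (i + l) (vs[j := x]) = ?us[j := twist V q x]" for x
        using il j by (simp add: take_update_swap map_update list_update_append)
      then show ?thesis
        using 1 il j by (simp only:) (rule cochain_compose_update[OF \<phi> twist_linear], simp)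
    next
      case 2
      then have "map (twist V q) (take i (vs[j := x])) @ [\<chi> (take l (drop i (vs[j := x])))]
          @ drop (i + l) (vs[j := x]) = ?us[i := \<chi> ((take l (drop i vs))[j - i := x])]" for x
        using il j by (simp add: take_update_swap drop_update_swap list_update_append list_update_beyond)
      moreover have "Vector_Spaces.linear (sc V) (sc V) (\<lambda>x. \<chi> ((take l (drop i vs))[j - i := x]))"
        using 2 il j by (intro cochain_update[OF \<chi>]) simp
      ultimately show ?thesis
        using 2 il j by (simp only:) (rule cochain_compose_update[OF \<phi>], simp_all)
    next
      case 3
      \<comment> \<open>Since \<open>l\<close> entries are replaced by one, position
        \<open>j\<close> becomes \<open>Suc (j - l)\<close>. The boundary case \<open>l = 0\<close>,
        \<open>j = i\<close> is separated because there \<open>j - i\<close> is no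
        successor.\<close>
      have "j - i = Suc (j - Suc i) \<or> l = 0 \<and> j = i" using 3 by linarith
      then have "map (twist V q) (take i (vs[j := x])) @ [\<chi> (take l (drop i (vs[j := x])))]
          @ drop (i + l) (vs[j := x]) = ?us[Suc (j - l) := x]" for x
        using 3 il j by (auto simp: drop_update_swap list_update_append Suc_diff_le add.commute[of l i])
      then show ?thesis
        using 3 il j by (simp only:) (rule cochain_update[OF \<phi>], simp)
    qed
  qed
  then show "Vector_Spaces.linear (sc V) (sc V) (\<lambda>x. circ V \<phi> \<chi> (vs[j := x]))"
    unfolding circ_parity_sum[OF assms] by (auto intro!: linear_sum)
qed

lemma bracket_cochain:
  assumes "\<phi> \<in> cochains V" "\<chi> \<in> cochains V" "has_parity V p \<phi>" "has_parity V q \<chi>"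
  shows "bracket V \<phi> \<chi> \<in> cochains V"
  unfolding bracket_homogeneous[OF assms]
  using assms by (intro diff_cochain koszul_cochain) (auto intro: circ_cochain)

lemma bracket_parity:
  assumes "\<phi> \<in> cochains V" "\<chi> \<in> cochains V" "has_parity V p \<phi>" "has_parity V q \<chi>"
  shows "has_parity V (p + q) (bracket V \<phi> \<chi>)"
  unfolding bracket_homogeneous[OF assms]
  using circ_parity[OF assms(1,2,3,4)] circ_parity[OF assms(2,1,4,3)]
  by (intro has_parity_diff has_parity_koszul) (simp_all only: add.commute)

text \<open>The bracket with the part of \<open>\<chi>\<close> of parity \<open>r\<close> is
  homogeneous of parity \<open>p + r\<close>, so the part of parity \<open>p + q\<close> of the
  whole bracket comes from \<open>r = q\<close> alone.\<close>

lemma bracket_hpart: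
  assumes "\<phi> \<in> cochains V" "\<chi> \<in> cochains V" "has_parity V p \<phi>"
  shows "bracket V \<phi> (hpart V q \<chi>) = hpart V (p + q) (bracket V \<phi> \<chi>)"
proof -
  have "hpart V (p + q) (bracket V \<phi> (hpart V r \<chi>)) =
      (if r = q then bracket V \<phi> (hpart V q \<chi>) else 0)" for r
    using hpart_homogeneous[OF
        bracket_cochain[OF assms(1) hpart_cochain[OF assms(2)] assms(3) hpart_parity[OF assms(2)]]
        bracket_parity[OF assms(1) hpart_cochain[OF assms(2)] assms(3) hpart_parity[OF assms(2)]]]
    by (simp only: add_left_cancel) auto
  moreover have "bracket V \<phi> \<chi> = bracket V \<phi> (hpart V 0 \<chi>) + bracket V \<phi> (hpart V 1 \<chi>)"
    using assms by (simp add: hpart_sum flip: bracket_add_right)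
  ultimately show ?thesis by (cases q) (simp_all add: hpart_add)
qed

section \<open>Compositions in low arity\<close>

lemma circ_arity:
  assumes "\<phi> \<in> cochains V" "\<chi> \<in> cochains V" "has_parity V q \<chi>"
    and "\<And>us. length us \<noteq> k \<Longrightarrow> \<phi> us = 0" "\<And>us. length us \<noteq> l \<Longrightarrow> \<chi> us = 0"
    and "length vs + 1 \<noteq> k + l"
  shows "circ V \<phi> \<chi> vs = 0"
proof -
  \<comment> \<open>For \<open>j = l\<close> the outer cochain receives
    \<open>length vs - l + 1\<close> arguments, which is not \<open>k\<close>; for other
    \<open>j\<close> the inner cochain vanishes.\<close>
  have "\<phi> (map (twist V q) (take i vs) @ [\<chi> (take j (drop i vs))] @ drop (i + j) vs) = 0"
    if "i \<le> length vs" "j \<le> length vs - i" for i j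
  proof (cases "j = l")
    case True
    then show ?thesis using that assms(6) by (intro assms(4)) simp
  next
    case False
    then have "\<chi> (take j (drop i vs)) = 0" using that by (intro assms(5)) simp
    then show ?thesis by (simp add: cochain_zero[OF assms(1)])
  qed
  then show ?thesis unfolding circ_parity_sum[OF assms(1-3)] by simp
qed

text \<open>The twist is the sign for moving \<open>\<chi>\<close> past \<open>u\<close>. On a
  completely odd space with \<open>q = 1\<close> it is negation, and \<open>\<phi> = \<chi>\<close>
  gives the usual associator.\<close>

lemma circ_binary_binary:
  assumes "\<phi> \<in> cochains V" "\<chi> \<in> cochains V" "has_parity V q \<chi>"
    and "\<And>us. length us \<noteq> 2 \<Longrightarrow> \<phi> us = 0" "\<And>us. length us \<noteq> 2 \<Longrightarrow> \<chi> us = 0"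
  shows "circ V \<phi> \<chi> [u, v, w] = \<phi> [\<chi> [u, v], w] + \<phi> [twist V q u, \<chi> [v, w]]"
  using assms(4,5) unfolding circ_parity_sum[OF assms(1-3)] by (simp add: numeral_eq_Suc)

lemma circ_binary_unary:
  assumes "\<phi> \<in> cochains V" "\<chi> \<in> cochains V" "has_parity V q \<chi>"
    and "\<And>us. length us \<noteq> 2 \<Longrightarrow> \<phi> us = 0" "\<And>us. length us \<noteq> 1 \<Longrightarrow> \<chi> us = 0"
  shows "circ V \<phi> \<chi> [u, v] = \<phi> [\<chi> [u], v] + \<phi> [twist V q u, \<chi> [v]]"
  using assms(4,5) unfolding circ_parity_sum[OF assms(1-3)] by (simp add: numeral_eq_Suc)

lemma circ_unary_binary:
  assumes "\<phi> \<in> cochains V" "\<chi> \<in> cochains V" "has_parity V q \<chi>"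
    and "\<And>us. length us \<noteq> 1 \<Longrightarrow> \<phi> us = 0" "\<And>us. length us \<noteq> 2 \<Longrightarrow> \<chi> us = 0"
  shows "circ V \<phi> \<chi> [u, v] = \<phi> [\<chi> [u, v]]"
  using assms(4,5) unfolding circ_parity_sum[OF assms(1-3)] by (simp add: numeral_eq_Suc)

text \<open>Intended for composites that vanish because the inner cochain takes its values in a
  summand on which the outer one is zero.\<close>

lemma circ_binary_eq_0I:
  assumes "\<phi> \<in> cochains V" "\<chi> \<in> cochains V" "has_parity V q \<chi>"
    and "\<And>us. length us \<noteq> 2 \<Longrightarrow> \<phi> us = 0" "\<And>us. length us \<noteq> 2 \<Longrightarrow> \<chi> us = 0"
    and "\<And>u v w. \<phi> [\<chi> [u, v], w] = 0" "\<And>u v w. \<phi> [w, \<chi> [u, v]] = 0"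
  shows "circ V \<phi> \<chi> = 0"
proof
  fix vs
  show "circ V \<phi> \<chi> vs = 0 vs"
  proof (cases "length vs = 3")
    case True
    then obtain u v w where "vs = [u, v, w]" by (auto simp: numeral_3_eq_3 length_Suc_conv)
    then show ?thesis using assms(6,7) by (simp add: circ_binary_binary[OF assms(1-5)])
  qed (simp add: circ_arity[OF assms(1-5)])
qed

end


section \<open>Bijections between quotients\<close>

lemma equiv_pullback:
  assumes "equiv B s" and f: "\<And>x. x \<in> A \<Longrightarrow> f x \<in> B" and "r \<subseteq> A \<times> A"
    and iff: "\<And>x y. x \<in> A \<Longrightarrow> y \<in> A \<Longrightarrow> (x, y) \<in> r \<longleftrightarrow> (f x, f y) \<in> s"
  shows "equiv A r"
proof (rule equivI)
  have s: "refl_on B s" "sym s" "trans s" using assms(1) by (auto elim: equivE)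
  show "refl_on A r" using s(1) f iff by (auto intro!: refl_onI dest: refl_onD)
  show "sym r" using s(2) iff assms(3) by (intro symI) (blast dest: symD)
  show "trans r" using s(3) iff assms(3) by (intro transI) (blast dest: transD)
  show "r \<subseteq> A \<times> A" by fact
qed

text \<open>One direction of the equivalence in \<open>iff\<close> makes the induced map well
  defined, the other makes it injective. Since \<open>f\<close> may miss classes, the target
  consists of those classes that meet its image; later these are the classes with an odd
  representative.\<close>

lemma quotient_bij_betw:
  assumes "equiv A r" "equiv B s" and f: "\<And>x. x \<in> A \<Longrightarrow> f x \<in> B"
    and iff: "\<And>x y. x \<in> A \<Longrightarrow> y \<in> A \<Longrightarrow> (x, y) \<in> r \<longleftrightarrow> (f x, f y) \<in> s"
  shows "\<exists>\<Phi>. bij_betw \<Phi> (A // r) {c \<in> B // s. \<exists>x\<in>A. f x \<in> c} \<and>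
    (\<forall>x\<in>A. \<Phi> (r `` {x}) = s `` {f x})"
proof (intro exI conjI ballI)
  \<comment> \<open>Saturating the image of a whole class avoids choosing a representative.\<close>
  let ?\<Phi> = "\<lambda>C. s `` (f ` C)"
  show \<Phi>: "?\<Phi> (r `` {x}) = s `` {f x}" if x: "x \<in> A" for x
  proof -
    have "s `` {f y} = s `` {f x}" if "(x, y) \<in> r" for y
      using that x iff assms(1,2) by (metis equiv_class_eq_iff)
    moreover have "(x, x) \<in> r" using x assms(1) by (meson equivE refl_onD)
    ultimately show ?thesis by blast
  qed
  show "bij_betw ?\<Phi> (A // r) {c \<in> B // s. \<exists>x\<in>A. f x \<in> c}"
    unfolding bij_betw_def
  proof
    show "inj_on ?\<Phi> (A // r)"
    proof (rule inj_onI, elim quotientE)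
      fix C D x y assume "?\<Phi> C = ?\<Phi> D" and x: "x \<in> A" "C = r `` {x}" and y: "y \<in> A" "D = r `` {y}"
      then have "s `` {f x} = s `` {f y}" by (simp only: \<Phi>)
      then have "(f x, f y) \<in> s" using f y assms(2) by (meson eq_equiv_class)
      then show "C = D" using x y iff assms(1) by (metis equiv_class_eq)
    qed
    show "?\<Phi> ` (A // r) = {c \<in> B // s. \<exists>x\<in>A. f x \<in> c}" (is "_ = ?R")
    proof
      show "?\<Phi> ` (A // r) \<subseteq> ?R"
      proof
        fix c assume "c \<in> ?\<Phi> ` (A // r)"
        then obtain x where "x \<in> A" "c = s `` {f x}" by (auto elim!: quotientE simp: \<Phi>)
        moreover from this have "f x \<in> s `` {f x}" using f equiv_class_self[OF assms(2)] by blast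
        ultimately show "c \<in> ?R" using f by (blast intro: quotientI)
      qed
      show "?R \<subseteq> ?\<Phi> ` (A // r)"
      proof
        fix c assume "c \<in> ?R"
        then obtain x where x: "x \<in> A" "f x \<in> c" and "c \<in> B // s" by blast
        then have "c = s `` {f x}"
          using assms(2) by (auto elim!: quotientE dest: equiv_class_eq)
        then have "c = ?\<Phi> (r `` {x})" using x \<Phi> by simp
        then show "c \<in> ?\<Phi> ` (A // r)" using x by (auto intro: quotientI)
      qed
    qed
  qed
qed


section \<open>Cochains on a direct sum\<close>

locale graded_pair = M: graded_vector_space M + W: graded_vector_space W
  for M :: "('k::field, 'm::ab_group_add) graded_space"
    and W :: "('k, 'w::ab_group_add) graded_space"
begin

abbreviation "V \<equiv> M \<oplus>\<^sub>g W"

sublocale V: graded_vector_space V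
  by (rule graded_vector_space_direct_sum) unfold_locales

lemma component_direct_sum:
  "component V p u = (component M p (fst u), component W p (snd u))"
  by (rule V.component_eqI; unfold direct_sum_def mem_Times_iff)
    (simp_all only: graded_space.simps fst_conv snd_conv fst_diff snd_diff mem_Times_iff simp_thms
      M.component_in_part W.component_in_part M.component_complement W.component_complement)

lemma twist_direct_sum: "twist V p u = (twist M p (fst u), twist W p (snd u))"
  by (simp add: twist_def component_direct_sum UNIV_bit koszul_def)

lemma CklD:
  assumes "\<phi> \<in> Ckl M W k l"
  shows "\<phi> \<in> cochains V" "snd (\<phi> vs) = 0"
    and "length (filter isl xs) \<noteq> k \<or> length (filter (Not \<circ> isl) xs) \<noteq> l \<Longrightarrow> \<phi> (map embed xs) = 0"
proof -
  have "\<phi> vs \<in> UNIV \<times> {0}" using assms unfolding Ckl_def hom_kl_def by blast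
  then show "snd (\<phi> vs) = 0" by auto
qed (use assms in \<open>auto simp: Ckl_def hom_kl_def\<close>)

lemma CklI:
  assumes "\<phi> \<in> cochains V" "\<And>vs. snd (\<phi> vs) = 0"
    and "\<And>xs. length (filter isl xs) \<noteq> k \<or> length (filter (Not \<circ> isl) xs) \<noteq> l \<Longrightarrow>
      \<phi> (map embed xs) = 0"
  shows "\<phi> \<in> Ckl M W k l"
proof -
  have "range \<phi> \<subseteq> UNIV \<times> {0}" using assms(2) by (metis UNIV_I image_subsetI insertI1 mem_Times_iff)
  then show ?thesis using assms(1,3) unfolding Ckl_def hom_kl_def by blast
qed

lemma CWD:
  assumes "\<phi> \<in> CW M W l"
  shows "\<phi> \<in> cochains V" "fst (\<phi> vs) = 0"
    and "length (filter isl xs) \<noteq> 0 \<or> length (filter (Not \<circ> isl) xs) \<noteq> l \<Longrightarrow> \<phi> (map embed xs) = 0"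
proof -
  have "\<phi> vs \<in> {0} \<times> UNIV" using assms unfolding CW_def hom_kl_def by blast
  then show "fst (\<phi> vs) = 0" by auto
qed (use assms in \<open>auto simp: CW_def hom_kl_def\<close>)

lemma Ckl_zero: "0 \<in> Ckl M W k l"
  by (intro CklI) (simp_all add: V.zero_cochain)

lemma Ckl_add: "\<phi> \<in> Ckl M W k l \<Longrightarrow> \<chi> \<in> Ckl M W k l \<Longrightarrow> \<phi> + \<chi> \<in> Ckl M W k l"
  by (intro CklI) (simp_all add: V.add_cochain CklD)

lemma Ckl_diff: "\<phi> \<in> Ckl M W k l \<Longrightarrow> \<chi> \<in> Ckl M W k l \<Longrightarrow> \<phi> - \<chi> \<in> Ckl M W k l"
  by (intro CklI) (simp_all add: V.diff_cochain CklD)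

text \<open>Taking components respects the splitting into \<open>M\<close> and \<open>W\<close>. On
  a tagged list it acts entrywise and keeps the tags, hence also the numbers \<open>k\<close> and
  \<open>l\<close>.\<close>

lemma Ckl_hpart:
  assumes "\<phi> \<in> Ckl M W k l"
  shows "hpart V p \<phi> \<in> Ckl M W k l"
proof (rule CklI)
  show "hpart V p \<phi> \<in> cochains V" by (rule V.hpart_cochain[OF CklD(1)[OF assms]])
  show "snd (hpart V p \<phi> vs) = 0" for vs
    by (simp add: hpart_def snd_sum component_direct_sum CklD(2)[OF assms] W.component_zero)
  fix xs :: "('m + 'w) list"
  assume xs: "length (filter isl xs) \<noteq> k \<or> length (filter (Not \<circ> isl) xs) \<noteq> l"
  let ?c = "\<lambda>p. map_sum (component M p) (component W p)"
  have "\<phi> (map2 (component V) ps (map embed xs)) = 0" if "length ps = length xs" for ps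
  proof -
    have emb: "map2 (component V) ps (map embed xs) = map embed (map2 ?c ps xs)"
      and 1: "length (filter isl (map2 ?c ps xs)) = length (filter isl xs)"
      and 2: "length (filter (Not \<circ> isl) (map2 ?c ps xs)) = length (filter (Not \<circ> isl) xs)"
      using that
    proof (induction ps xs rule: list_induct2)
      case (Cons p ps x xs)
      { case 1 then show ?case using Cons
          by (cases x) (simp_all add: component_direct_sum M.component_zero W.component_zero) }
      { case 2 then show ?case using Cons by (cases x) simp_all }
      { case 3 then show ?case using Cons by (cases x) simp_all }
    qed simp_all
    show ?thesis unfolding emb by (rule CklD(3)[OF assms]) (simp only: 1 2 xs)
  qed
  then show "hpart V p \<phi> (map embed xs) = 0"
    by (simp add: hpart_def V.component_zero)
qed

section \<open>Splitting arguments into their \<open>M\<close>- and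
  \<open>W\<close>-components\<close>

lemma embed_decompose: "(v :: 'm \<times> 'w) = embed (Inl (fst v)) + embed (Inr (snd v))"
  by (simp add: prod_eq_iff)

text \<open>The arguments are split one at a time into their two components, which move as tagged
  entries into the prefix \<open>xs\<close>; the length stays the same throughout.\<close>

lemma arity_vanish:
  assumes "\<phi> \<in> cochains V" "\<And>xs. length xs \<noteq> n \<Longrightarrow> \<phi> (map embed xs) = 0"
  shows "length vs \<noteq> n \<Longrightarrow> \<phi> vs = 0"
proof -
  have "length xs + length vs \<noteq> n \<Longrightarrow> \<phi> (map embed xs @ vs) = 0" for xs
  proof (induction vs arbitrary: xs)
    case Nil
    then show ?case using assms(2) by simp
  next
    case (Cons v vs)
    have "\<phi> (map embed xs @ v # vs) =
        \<phi> (map embed (xs @ [Inl (fst v)]) @ vs) + \<phi> (map embed (xs @ [Inr (snd v)]) @ vs)"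
      by (subst embed_decompose[of v], subst V.cochain_add[OF assms(1)]) simp
    then show ?case using Cons.IH[of "xs @ [Inl (fst v)]"] Cons.IH[of "xs @ [Inr (snd v)]"] Cons.prems by simp
  qed
  from this[of "[]"] show "length vs \<noteq> n \<Longrightarrow> \<phi> vs = 0" by simp
qed

lemma length_isl: "length (filter isl xs) + length (filter (Not \<circ> isl) xs) = length xs"
  using sum_length_filter_compl[of isl xs] by (simp add: o_def)

lemma Ckl_arity: "\<phi> \<in> Ckl M W k l \<Longrightarrow> length vs \<noteq> k + l \<Longrightarrow> \<phi> vs = 0"
proof (rule arity_vanish[OF CklD(1)])
  assume \<phi>: "\<phi> \<in> Ckl M W k l"
  show "\<phi> (map embed xs) = 0" if "length xs \<noteq> k + l" for xs
    by (rule CklD(3)[OF \<phi>]) (use that length_isl[of xs] in linarith)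
qed

lemma CW_arity: "\<phi> \<in> CW M W l \<Longrightarrow> length vs \<noteq> l \<Longrightarrow> \<phi> vs = 0"
proof (rule arity_vanish[OF CWD(1)])
  assume \<phi>: "\<phi> \<in> CW M W l"
  show "\<phi> (map embed xs) = 0" if "length xs \<noteq> l" for xs
    by (rule CWD(3)[OF \<phi>]) (use that length_isl[of xs] in linarith)
qed

lemma binary_add:
  assumes "\<phi> \<in> cochains V"
  shows "\<phi> [x + y, v] = \<phi> [x, v] + \<phi> [y, v]" "\<phi> [v, x + y] = \<phi> [v, x] + \<phi> [v, y]"
  using V.cochain_add[OF assms, of "[]"] V.cochain_add[OF assms, of "[v]"] by simp_all

lemma unary_add: "\<phi> \<in> cochains V \<Longrightarrow> \<phi> [x + y] = \<phi> [x] + \<phi> [y]"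
  using V.cochain_add[of \<phi> "[]"] by simp

text \<open>After splitting \<open>v\<close>, each term still contains the entry \<open>u\<close>
  from \<open>M\<close>. The general form serves both \<delta> and \<psi>, which differ in their
  target.\<close>

lemma C02_vanish:
  assumes "\<phi> \<in> cochains V" "\<And>xs. length (filter isl xs) \<noteq> 0 \<Longrightarrow> \<phi> (map embed xs) = 0"
    and "snd u = 0"
  shows "\<phi> [u, v] = 0" "\<phi> [v, u] = 0"
proof -
  have u: "u = embed (Inl (fst u))" using assms(3) by (simp add: prod_eq_iff)
  have "\<phi> [embed (Inl m), embed x] = 0" "\<phi> [embed x, embed (Inl m)] = 0" for m x
    using assms(2)[of "[Inl m, x]"] assms(2)[of "[x, Inl m]"] by simp_all
  then show "\<phi> [u, v] = 0" "\<phi> [v, u] = 0"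
    using u binary_add[OF assms(1)] embed_decompose[of v] by (metis add_0_left)+
qed

lemma CW2_vanish:
  assumes "\<delta> \<in> CW M W 2" "snd u = 0"
  shows "\<delta> [u, v] = 0" "\<delta> [v, u] = 0"
  using C02_vanish[OF CWD(1)[OF assms(1)] _ assms(2)] CWD(3)[OF assms(1)] by blast+

lemma Ckl02_vanish:
  assumes "\<psi> \<in> Ckl M W 0 2" "snd u = 0"
  shows "\<psi> [u, v] = 0" "\<psi> [v, u] = 0"
  using C02_vanish[OF CklD(1)[OF assms(1)] _ assms(2)] CklD(3)[OF assms(1)] by blast+

lemma C20_vanish:
  assumes "\<mu> \<in> Ckl M W 2 0" "fst u = 0"
  shows "\<mu> [u, v] = 0" "\<mu> [v, u] = 0"
proof -
  have u: "u = embed (Inr (snd u))" using assms(2) by (simp add: prod_eq_iff)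
  have "\<mu> [embed (Inr w), embed x] = 0" "\<mu> [embed x, embed (Inr w)] = 0" for w x
    using CklD(3)[OF assms(1), of "[Inr w, x]"] CklD(3)[OF assms(1), of "[x, Inr w]"] by simp_all
  then show "\<mu> [u, v] = 0" "\<mu> [v, u] = 0"
    using u binary_add[OF CklD(1)[OF assms(1)]] embed_decompose[of v] by (metis add_0_left)+
qed

lemma C11_vanish:
  assumes "\<kappa> \<in> Ckl M W 1 1"
  shows "snd u = 0 \<Longrightarrow> snd v = 0 \<Longrightarrow> \<kappa> [u, v] = 0"
    and "fst u = 0 \<Longrightarrow> fst v = 0 \<Longrightarrow> \<kappa> [u, v] = 0"
proof -
  assume "snd u = 0" "snd v = 0"
  then have "[u, v] = map embed [Inl (fst u), Inl (fst v)]" by (simp add: prod_eq_iff)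
  then show "\<kappa> [u, v] = 0" using CklD(3)[OF assms, of "[Inl (fst u), Inl (fst v)]"] by simp
next
  assume "fst u = 0" "fst v = 0"
  then have "[u, v] = map embed [Inr (snd u), Inr (snd v)]" by (simp add: prod_eq_iff)
  then show "\<kappa> [u, v] = 0" using CklD(3)[OF assms, of "[Inr (snd u), Inr (snd v)]"] by simp
qed

lemma C01_vanish:
  assumes "\<beta> \<in> Ckl M W 0 1" "snd u = 0"
  shows "\<beta> [u] = 0"
proof -
  have "[u] = map embed [Inl (fst u)]" using assms(2) by (simp add: prod_eq_iff)
  then show ?thesis using CklD(3)[OF assms(1), of "[Inl (fst u)]"] by simp
qed

lemma C02_project:
  assumes "\<psi> \<in> Ckl M W 0 2"
  shows "\<psi> [(0, snd u), v] = \<psi> [u, v]" "\<psi> [v, (0, snd u)] = \<psi> [v, u]"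
proof -
  have add: "\<psi> [u, v] = \<psi> [(fst u, 0), v] + \<psi> [(0, snd u), v]"
    "\<psi> [v, u] = \<psi> [v, (fst u, 0)] + \<psi> [v, (0, snd u)]"
    using binary_add[OF CklD(1)[OF assms], where x = "(fst u, 0)" and y = "(0, snd u)" and v = v]
    by simp_all
  note zero = Ckl02_vanish[OF assms, where u = "(fst u, 0)" and v = v]
  show "\<psi> [(0, snd u), v] = \<psi> [u, v]" using add(1) zero(1) by simp
  show "\<psi> [v, (0, snd u)] = \<psi> [v, u]" using add(2) zero(2) by simp
qed

end


section \<open>Extensions with fixed bimodule structure\<close>

locale extension_data = graded_pair M W
  for M :: "('k::field, 'm::ab_group_add) graded_space"
    and W :: "('k, 'w::ab_group_add) graded_space" +
  fixes \<delta> \<mu> \<kappa> :: "('m \<times> 'w) cochain"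
  assumes char: "CHAR('k) \<noteq> 2"
    and \<delta>: "\<delta> \<in> CW M W 2" and \<delta>_odd: "odd_cochain V \<delta>" and \<delta>\<delta>: "bracket V \<delta> \<delta> = 0"
    and \<mu>: "\<mu> \<in> Ckl M W 2 0" and \<mu>_odd: "odd_cochain V \<mu>" and \<mu>\<mu>: "bracket V \<mu> \<mu> = 0"
    and \<kappa>: "\<kappa> \<in> Ckl M W 1 1" and \<kappa>_odd: "odd_cochain V \<kappa>"
    and \<delta>\<kappa>: "bracket V \<delta> \<kappa> + scale_cochain V (1 / 2) (bracket V \<kappa> \<kappa>) = 0"
    and \<mu>\<kappa>: "bracket V \<mu> \<kappa> = 0"
begin

section \<open>The structure equations in terms of compositions\<close>

abbreviation "\<alpha> \<equiv> \<delta> + \<kappa>"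

lemmas cochain = CWD(1)[OF \<delta>] CklD(1)[OF \<mu>] CklD(1)[OF \<kappa>]

lemma \<alpha>_cochain: "\<alpha> \<in> cochains V" and \<alpha>_odd: "odd_cochain V \<alpha>"
  by (simp_all only: V.add_cochain cochain V.has_parity_add \<delta>_odd \<kappa>_odd)

lemma arity:
  "length vs \<noteq> 2 \<Longrightarrow> \<delta> vs = 0" "length vs \<noteq> 2 \<Longrightarrow> \<mu> vs = 0" "length vs \<noteq> 2 \<Longrightarrow> \<kappa> vs = 0"
  "length vs \<noteq> 2 \<Longrightarrow> \<alpha> vs = 0"
  using CW_arity[OF \<delta>] Ckl_arity[OF \<mu>] Ckl_arity[OF \<kappa>] by (simp_all add: numeral_eq_Suc)

text \<open>As rewrite rules these let the simplifier discard a term as soon as the summand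
  containing an argument is known.\<close>

lemmas sector [simp] = CWD(2)[OF \<delta>] CklD(2)[OF \<mu>] CklD(2)[OF \<kappa>]
  CW2_vanish[OF \<delta>] C20_vanish[OF \<mu>] C11_vanish[OF \<kappa>]

text \<open>Otherwise the characteristic divides 2; being neither 0 nor 2 it would be 1, which a
  field excludes.\<close>

lemma two_neq_0: "(2 :: 'k) \<noteq> 0"
proof
  assume "(2 :: 'k) = 0"
  then have "of_nat 2 = (0 :: 'k)" by simp
  then have "CHAR('k) dvd 2" by (simp only: of_nat_eq_0_iff_char_dvd)
  then have "CHAR('k) \<le> 2" "CHAR('k) \<noteq> 0" using dvd_imp_le[of "CHAR('k)" 2] by (simp, metis dvd_0_left_iff zero_neq_numeral)
  then have "CHAR('k) = 1" using char by linarith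
  then show False by simp
qed

lemma double_eq_0: "x + x = 0 \<longleftrightarrow> x = 0" for x :: "'m \<times> 'w"
proof
  assume "x + x = 0"
  then have "sc V (1 / 2) (x + x) = 0" by simp
  then have "sc V (1 / 2 + 1 / 2) x = 0"
    by (simp only: V.scale_right_distrib V.scale_left_distrib)
  then show "x = 0" using two_neq_0 by simp
qed simp

text \<open>For odd \<open>d\<close> the bracket \<open>[d, d]\<close> is twice
  \<open>circ V d d\<close>, so this turns a vanishing self-bracket into a vanishing
  self-composition.\<close>

lemma double_cochain_eq_0: "\<phi> + \<phi> = 0 \<longleftrightarrow> \<phi> = 0" for \<phi> :: "('m \<times> 'w) cochain"
  by (simp add: fun_eq_iff double_eq_0)

lemma half_double: "sc V (1 / 2) (x + x) = x"
  by (simp only: V.scale_right_distrib flip: V.scale_left_distrib) (simp add: two_neq_0)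

text \<open>Between odd cochains the bracket is the anticommutator; in particular the factor
  \<open>1 / 2\<close> cancels against the two equal terms of
  \<open>bracket V \<kappa> \<kappa>\<close>.\<close>

lemma circ_relations:
  "circ V \<delta> \<delta> = 0" "circ V \<mu> \<mu> = 0" "circ V \<mu> \<kappa> + circ V \<kappa> \<mu> = 0"
  "circ V \<delta> \<kappa> + circ V \<kappa> \<delta> + circ V \<kappa> \<kappa> = 0"
proof -
  show "circ V \<delta> \<delta> = 0" "circ V \<mu> \<mu> = 0" "circ V \<mu> \<kappa> + circ V \<kappa> \<mu> = 0"
    using \<delta>\<delta> \<mu>\<mu> \<mu>\<kappa>
    by (simp_all add: V.bracket_odd cochain \<delta>_odd \<mu>_odd \<kappa>_odd double_cochain_eq_0)
  have "scale_cochain V (1 / 2) (bracket V \<kappa> \<kappa>) = circ V \<kappa> \<kappa>"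
    by (rule ext) (simp add: scale_cochain_def V.bracket_odd cochain \<kappa>_odd half_double)
  then show "circ V \<delta> \<kappa> + circ V \<kappa> \<delta> + circ V \<kappa> \<kappa> = 0"
    using \<delta>\<kappa> by (simp add: V.bracket_odd cochain \<delta>_odd \<kappa>_odd)
qed

section \<open>The codifferential condition for a given \<psi>\<close>

context
  fixes \<psi>
  assumes \<psi>: "\<psi> \<in> Ckl M W 0 2" and \<psi>_odd: "odd_cochain V \<psi>"
begin

lemmas \<psi>_sector [simp] = CklD(2)[OF \<psi>] Ckl02_vanish[OF \<psi>]
lemmas \<psi>_arity = Ckl_arity[OF \<psi>, unfolded add_0_left]

text \<open>The values of \<mu> and \<psi> lie in \<open>M\<close>, which \<delta> and \<psi>
  annihilate; those of \<delta> lie in \<open>W\<close>, which \<mu> annihilates.\<close>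

lemma circ_sector:
  "circ V \<delta> \<mu> = 0" "circ V \<mu> \<delta> = 0" "circ V \<psi> \<psi> = 0" "circ V \<delta> \<psi> = 0" "circ V \<psi> \<mu> = 0"
  by (rule V.circ_binary_eq_0I[where q = 1];
      simp add: cochain CklD(1)[OF \<psi>] \<delta>_odd \<mu>_odd \<psi>_odd arity \<psi>_arity)+

lemma bracket_\<mu>_\<psi>: "bracket V \<mu> \<psi> = circ V \<mu> \<psi>"
  using V.bracket_odd[OF CklD(1)[OF \<mu>] CklD(1)[OF \<psi>] \<mu>_odd \<psi>_odd] by (simp add: circ_sector)

lemma bracket_\<alpha>_\<psi>: "bracket V \<alpha> \<psi> = circ V \<kappa> \<psi> + circ V \<psi> \<alpha>"
  using V.bracket_odd[OF \<alpha>_cochain CklD(1)[OF \<psi>] \<alpha>_odd \<psi>_odd]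
  by (simp add: circ_sector V.circ_add_left)

lemma total_cochain: "\<delta> + \<mu> + \<kappa> + \<psi> \<in> cochains V" and total_odd: "odd_cochain V (\<delta> + \<mu> + \<kappa> + \<psi>)"
  by (simp_all only: V.add_cochain cochain CklD(1)[OF \<psi>] V.has_parity_add \<delta>_odd \<mu>_odd \<kappa>_odd \<psi>_odd)

lemma circ_total:
  "circ V (\<delta> + \<mu> + \<kappa> + \<psi>) (\<delta> + \<mu> + \<kappa> + \<psi>) = bracket V \<mu> \<psi> + bracket V \<alpha> \<psi>"
proof -
  \<comment> \<open>Seven of the sixteen composites vanish by \<open>circ_sector\<close> and the
    first two relations. The last two groups are the left-hand sides of the relations for
    \<kappa>.\<close>
  have "circ V (\<delta> + \<mu> + \<kappa> + \<psi>) (\<delta> + \<mu> + \<kappa> + \<psi>) =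
      circ V \<mu> \<psi> + (circ V \<kappa> \<psi> + (circ V \<psi> \<delta> + circ V \<psi> \<kappa>)) +
      (circ V \<mu> \<kappa> + circ V \<kappa> \<mu>) + (circ V \<delta> \<kappa> + circ V \<kappa> \<delta> + circ V \<kappa> \<kappa>)"
    by (simp add: V.circ_add_left V.circ_add_right cochain CklD(1)[OF \<psi>] V.add_cochain
        circ_sector circ_relations(1,2))
  then show ?thesis
    by (simp add: circ_relations(3,4) bracket_\<mu>_\<psi> bracket_\<alpha>_\<psi> V.circ_add_right CklD(1)[OF \<psi>])
qed

text \<open>The two brackets live in \<open>C\<^bsup>1,2\<^esup>\<close> and \<open>C\<^bsup>0,3\<^esup>\<close>; restricting all arguments to \<open>W\<close> kills the
  first and does not change the second.\<close>

lemma brackets_independent: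
  "bracket V \<mu> \<psi> + bracket V \<alpha> \<psi> = 0 \<longleftrightarrow> bracket V \<mu> \<psi> = 0 \<and> bracket V \<alpha> \<psi> = 0"
proof
  assume sum: "bracket V \<mu> \<psi> + bracket V \<alpha> \<psi> = 0"
  note c = cochain \<alpha>_cochain CklD(1)[OF \<psi>] \<delta>_odd \<mu>_odd \<kappa>_odd \<alpha>_odd \<psi>_odd arity \<psi>_arity
  have \<mu>: "bracket V \<mu> \<psi> [u, v, w] = \<mu> [\<psi> [u, v], w] + \<mu> [twist V 1 u, \<psi> [v, w]]" for u v w
    unfolding bracket_\<mu>_\<psi> by (rule V.circ_binary_binary) (simp_all add: c)
  have \<alpha>: "bracket V \<alpha> \<psi> [u, v, w] = \<kappa> [\<psi> [u, v], w] + \<kappa> [twist V 1 u, \<psi> [v, w]] +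
      (\<psi> [\<alpha> [u, v], w] + \<psi> [twist V 1 u, \<alpha> [v, w]])" for u v w
    unfolding bracket_\<alpha>_\<psi> plus_fun_apply[of "circ V \<kappa> \<psi>"]
    by (intro arg_cong2[where f = "(+)"] V.circ_binary_binary) (simp_all add: c)
  \<comment> \<open>Next to an argument in \<open>M\<close>, \<kappa> sees only the
    \<open>W\<close>-component of the other one. In the formula for
    \<open>bracket V \<alpha> \<psi>\<close> that neighbour is a value of \<psi>.\<close>
  have \<kappa>_project: "\<kappa> [x, (0, snd w)] = \<kappa> [x, w]" "\<kappa> [(0, snd w), x] = \<kappa> [w, x]"
    if "snd x = 0" for x w
    using binary_add[OF CklD(1)[OF \<kappa>], where x = "(fst w, 0)" and y = "(0, snd w)" and v = x] that by simp_all
  have \<delta>_project: "\<delta> [(0, snd u), v] = \<delta> [u, v]" "\<delta> [v, (0, snd u)] = \<delta> [v, u]" for u v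
    using binary_add[OF CWD(1)[OF \<delta>], where x = "(fst u, 0)" and y = "(0, snd u)" and v = v] by simp_all
  have \<psi>_add: "\<psi> [x + y, v] = \<psi> [x, v] + \<psi> [y, v]" "\<psi> [v, x + y] = \<psi> [v, x] + \<psi> [v, y]" for x y v
    using binary_add[OF CklD(1)[OF \<psi>]] by simp_all
  have tw: "twist V 1 (0, snd u) = (0, snd (twist V 1 u))" for u
    by (simp add: twist_direct_sum M.twist_zero)
  have "bracket V \<alpha> \<psi> [u, v, w] = 0" for u v w
  proof -
    have "bracket V \<alpha> \<psi> [u, v, w] = bracket V \<alpha> \<psi> [(0, snd u), (0, snd v), (0, snd w)]"
      by (simp add: \<alpha> tw \<psi>_add \<kappa>_project \<delta>_project C02_project[OF \<psi>])
    also have "bracket V \<mu> \<psi> [(0, snd u), (0, snd v), (0, snd w)] = 0" by (simp add: \<mu> tw)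
    then have "bracket V \<alpha> \<psi> [(0, snd u), (0, snd v), (0, snd w)] = 0"
      using fun_cong[OF sum, of "[(0, snd u), (0, snd v), (0, snd w)]"] by simp
    finally show ?thesis .
  qed
  moreover have "bracket V \<alpha> \<psi> vs = 0" if "length vs \<noteq> 3" for vs
  proof -
    have "circ V \<kappa> \<psi> vs = 0" by (rule V.circ_arity[where k = 2 and l = 2 and q = 1]) (simp_all add: c that)
    \<comment> \<open>The pointwise sum must stay folded here, so that the arity rule for \<alpha>
      as a single cochain applies.\<close>
    moreover have "circ V \<psi> \<alpha> vs = 0"
      by (rule V.circ_arity[where k = 2 and l = 2 and q = 1]) (simp_all add: c that del: plus_fun_apply)
    ultimately show ?thesis by (simp add: bracket_\<alpha>_\<psi>)
  qed
  ultimately have "bracket V \<alpha> \<psi> vs = 0" for vs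
    by (cases "length vs = 3") (auto simp: numeral_3_eq_3 length_Suc_conv)
  then have "bracket V \<alpha> \<psi> = 0" by (intro ext) simp
  then show "bracket V \<mu> \<psi> = 0 \<and> bracket V \<alpha> \<psi> = 0" using sum by simp
qed simp

lemma codifferential_iff:
  "codifferential V (\<delta> + \<mu> + \<kappa> + \<psi>) \<longleftrightarrow> bracket V \<mu> \<psi> = 0 \<and> bracket V \<alpha> \<psi> = 0"
  unfolding codifferential_def V.bracket_odd[OF total_cochain total_cochain total_odd total_odd]
    double_cochain_eq_0 circ_total brackets_independent
  using total_cochain total_odd by blast

lemma extensions_by_iff:
  "\<delta> + \<mu> + \<kappa> + \<psi> \<in> extensions_by M W \<delta> \<mu> \<kappa> \<longleftrightarrow> bracket V \<mu> \<psi> = 0 \<and> bracket V \<alpha> \<psi> = 0"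
  unfolding extensions_by_def extensions_def mem_Collect_eq codifferential_iff
  using \<psi> \<psi>_odd \<kappa> \<kappa>_odd by blast

end

text \<open>As \<beta> vanishes on \<open>M\<close> and has values in \<open>M\<close>, it squares
  to zero and \<open>exp_map \<beta>\<close> has inverse \<open>v - \<beta> [v]\<close>. In the
  bilinear expansion the terms linear in \<beta> form the two brackets. The only quadratic term
  comes from \<mu>, since \<delta>, \<psi> and \<kappa> vanish on two arguments from
  \<open>M\<close>.\<close>

lemma pullback_exp:
  assumes \<psi>: "\<psi> \<in> Ckl M W 0 2" and \<beta>: "\<beta> \<in> Ckl M W 0 1" and \<beta>_even: "even_cochain V \<beta>"
  shows "pullback (exp_map \<beta>) (\<delta> + \<mu> + \<kappa> + \<psi>) =
    \<delta> + \<mu> + \<kappa> + \<psi> + bracket V \<mu> \<beta> + bracket V \<alpha> \<beta> + (\<lambda>vs. \<mu> (map (\<lambda>v. \<beta> [v]) vs))"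
    and "bracket V \<mu> \<beta> [u, v] = \<mu> [\<beta> [u], v] + \<mu> [u, \<beta> [v]]"
    and "bracket V \<alpha> \<beta> [u, v] = \<kappa> [\<beta> [u], v] + \<kappa> [u, \<beta> [v]] - \<beta> [\<delta> [u, v]]"
    and "length vs \<noteq> 2 \<Longrightarrow> bracket V \<mu> \<beta> vs = 0"
    and "length vs \<noteq> 2 \<Longrightarrow> bracket V \<alpha> \<beta> vs = 0"
proof -
  note [simp] = CklD(2)[OF \<psi>] Ckl02_vanish[OF \<psi>]
    CklD(2)[OF \<beta>] C01_vanish[OF \<beta>]
  note c = cochain \<alpha>_cochain CklD(1)[OF \<beta>] \<delta>_odd \<mu>_odd \<kappa>_odd \<alpha>_odd \<beta>_even arity
    Ckl_arity[OF \<beta>, unfolded add_0_left]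
  note add = binary_add[OF CWD(1)[OF \<delta>]] binary_add[OF CklD(1)[OF \<mu>]] binary_add[OF CklD(1)[OF \<kappa>]]
    binary_add[OF CklD(1)[OF \<psi>]] unary_add[OF CklD(1)[OF \<beta>]]
  \<comment> \<open>Proved for any odd binary \<phi> and then specialized: for \<mu> the last term
    disappears, for \<alpha> only \<delta> survives in it, because \<beta> kills values in
    \<open>M\<close>.\<close>
  have eval: "bracket V \<phi> \<beta> [u, v] = \<phi> [\<beta> [u], v] + \<phi> [u, \<beta> [v]] - \<beta> [\<phi> [u, v]]"
    and eval0: "length vs \<noteq> 2 \<Longrightarrow> bracket V \<phi> \<beta> vs = 0"
    if \<phi>: "\<phi> \<in> cochains V" "odd_cochain V \<phi>" "\<And>vs. length vs \<noteq> 2 \<Longrightarrow> \<phi> vs = 0" for \<phi> u v vs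
  proof -
    note br = V.bracket_even[OF \<phi>(1) CklD(1)[OF \<beta>] \<phi>(2) \<beta>_even]
    have "circ V \<phi> \<beta> [u, v] = \<phi> [\<beta> [u], v] + \<phi> [twist V 0 u, \<beta> [v]]"
      by (rule V.circ_binary_unary[where q = 0]) (simp_all add: \<phi> c)
    moreover have "circ V \<beta> \<phi> [u, v] = \<beta> [\<phi> [u, v]]"
      by (rule V.circ_unary_binary[where q = 1]) (simp_all add: \<phi> c)
    ultimately show "bracket V \<phi> \<beta> [u, v] = \<phi> [\<beta> [u], v] + \<phi> [u, \<beta> [v]] - \<beta> [\<phi> [u, v]]"
      by (simp add: br V.twist_even)
    assume vs: "length vs \<noteq> 2"
    have "circ V \<phi> \<beta> vs = 0" by (rule V.circ_arity[where k = 2 and l = 1 and q = 0]) (simp_all add: \<phi> c vs)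
    moreover have "circ V \<beta> \<phi> vs = 0" by (rule V.circ_arity[where k = 1 and l = 2 and q = 1]) (simp_all add: \<phi> c vs flip: numeral_2_eq_2)
    ultimately show "bracket V \<phi> \<beta> vs = 0" by (simp add: br)
  qed
  show \<mu>\<beta>: "bracket V \<mu> \<beta> [u, v] = \<mu> [\<beta> [u], v] + \<mu> [u, \<beta> [v]]" for u v
    by (subst eval) (simp_all add: c)
  show \<alpha>\<beta>: "bracket V \<alpha> \<beta> [u, v] = \<kappa> [\<beta> [u], v] + \<kappa> [u, \<beta> [v]] - \<beta> [\<delta> [u, v]]" for u v
    by (subst eval) (simp_all add: \<alpha>_cochain \<alpha>_odd arity add)
  show \<mu>0: "length vs \<noteq> 2 \<Longrightarrow> bracket V \<mu> \<beta> vs = 0" for vs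
    by (rule eval0) (simp_all add: c)
  show \<alpha>0: "length vs \<noteq> 2 \<Longrightarrow> bracket V \<alpha> \<beta> vs = 0" for vs
    by (rule eval0[OF \<alpha>_cochain \<alpha>_odd arity(4)])
  have f: "exp_map \<beta> v = v + \<beta> [v]" for v
  proof -
    \<comment> \<open>Here \<open>add(9)\<close> is additivity of \<beta>; the
      \<open>M\<close>-component of \<open>v\<close> contributes nothing.\<close>
    have "\<beta> [v] = \<beta> [(0, snd v)]"
      using add(9)[of "(fst v, 0)" "(0, snd v)"] by simp
    then show ?thesis by (simp add: exp_map_def case_prod_unfold prod_eq_iff)
  qed
  have inv: "inv (exp_map \<beta>) = (\<lambda>v. v - \<beta> [v])"
  proof (rule inv_equality)
    fix v
    show "exp_map \<beta> v - \<beta> [exp_map \<beta> v] = v" by (simp add: f add)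
    have "\<beta> [v - \<beta> [v]] = \<beta> [v]" using add(9)[of "v - \<beta> [v]" "\<beta> [v]"] by simp
    then show "exp_map \<beta> (v - \<beta> [v]) = v" by (simp add: f)
  qed
  show "pullback (exp_map \<beta>) (\<delta> + \<mu> + \<kappa> + \<psi>) =
    \<delta> + \<mu> + \<kappa> + \<psi> + bracket V \<mu> \<beta> + bracket V \<alpha> \<beta> + (\<lambda>vs. \<mu> (map (\<lambda>v. \<beta> [v]) vs))"
  proof
    fix vs
    show "pullback (exp_map \<beta>) (\<delta> + \<mu> + \<kappa> + \<psi>) vs =
      (\<delta> + \<mu> + \<kappa> + \<psi> + bracket V \<mu> \<beta> + bracket V \<alpha> \<beta> + (\<lambda>vs. \<mu> (map (\<lambda>v. \<beta> [v]) vs))) vs"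
    proof (cases "length vs = 2")
      case True
      then obtain u v where vs: "vs = [u, v]" by (auto simp: numeral_2_eq_2 length_Suc_conv)
      show ?thesis unfolding vs by (simp add: pullback_def inv f \<mu>\<beta> \<alpha>\<beta> add algebra_simps)
    next
      case False
      then show ?thesis
        by (simp add: pullback_def inv c \<mu>0 \<alpha>0[simplified] Ckl_arity[OF \<psi>, unfolded add_0_left])
    qed
  qed
qed

text \<open>Each side forces \<mu> to vanish on pairs of an element of \<open>M\<close> and a value
  of \<beta>: on the left because \<psi>' - \<psi> vanishes once an argument lies in
  \<open>M\<close>, on the right because \<open>bracket V \<mu> \<beta>\<close> does. Then the
  bracket with \<mu> and the quadratic term both disappear.\<close>

lemma pullback_iff:
  assumes \<psi>: "\<psi> \<in> Ckl M W 0 2" "\<psi>' \<in> Ckl M W 0 2" and \<beta>: "\<beta> \<in> Ckl M W 0 1" "even_cochain V \<beta>"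
  shows "\<delta> + \<mu> + \<kappa> + \<psi>' = pullback (exp_map \<beta>) (\<delta> + \<mu> + \<kappa> + \<psi>) \<longleftrightarrow>
    bracket V \<mu> \<beta> = 0 \<and> \<psi>' - \<psi> = bracket V \<alpha> \<beta>"
proof -
  note pullback = pullback_exp[OF \<psi>(1) \<beta>]
  let ?Q = "\<lambda>vs. \<mu> (map (\<lambda>v. \<beta> [v]) vs)"
  have eq: "\<delta> + \<mu> + \<kappa> + \<psi>' = pullback (exp_map \<beta>) (\<delta> + \<mu> + \<kappa> + \<psi>) \<longleftrightarrow>
      \<psi>' - \<psi> = bracket V \<mu> \<beta> + bracket V \<alpha> \<beta> + ?Q"
    unfolding pullback(1) by (simp only: add.assoc add_left_cancel diff_eq_eq) (simp only: ac_simps)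
  \<comment> \<open>Testing against \<open>(m, 0)\<close> suffices because \<mu> ignores the
    \<open>W\<close>-component of its arguments.\<close>
  have \<mu>\<beta>: "bracket V \<mu> \<beta> = 0 \<and> ?Q = 0"
    if right: "\<And>m v. \<mu> [(m, 0), \<beta> [v]] = 0" and left: "\<And>m v. \<mu> [\<beta> [v], (m, 0)] = 0"
  proof -
    have 0: "\<mu> [u, \<beta> [v]] = 0" "\<mu> [\<beta> [v], u] = 0" for u v
      using binary_add[OF CklD(1)[OF \<mu>], where x = "(fst u, 0)" and y = "(0, snd u)" and v = "\<beta> [v]"] left right by simp_all
    have "bracket V \<mu> \<beta> vs = 0 \<and> ?Q vs = 0" for vs
    proof (cases "length vs = 2")
      case True
      then obtain u v where "vs = [u, v]" by (auto simp: numeral_2_eq_2 length_Suc_conv)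
      then show ?thesis by (simp add: pullback(2) 0)
    qed (simp add: pullback(4) arity(2))
    then show ?thesis by (intro conjI ext) simp_all
  qed
  note [simp] = CklD(2)[OF \<beta>(1)] C01_vanish[OF \<beta>(1)]
  show ?thesis
    unfolding eq
  proof (intro iffI)
    assume d: "\<psi>' - \<psi> = bracket V \<mu> \<beta> + bracket V \<alpha> \<beta> + ?Q"
    have "\<psi>' - \<psi> \<in> Ckl M W 0 2" using \<psi> by (simp add: Ckl_diff)
    note vanish = Ckl02_vanish[OF this, unfolded d plus_fun_apply pullback(2,3)]
    \<comment> \<open>With \<open>u = (m, 0)\<close>, the terms containing
      \<open>\<beta> [u]\<close> or \<open>\<delta>\<close> vanish, and \<kappa> vanishes on two
      arguments from \<open>M\<close>. One term with \<mu> is left.\<close>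
    have "\<mu> [(m, 0), \<beta> [v]] = 0" "\<mu> [\<beta> [v], (m, 0)] = 0" for m v
      using vanish[where v = v and u = "(m, 0)"]
      by (simp_all add: V.cochain_zero[OF CklD(1)[OF \<kappa>], where us = "[]", simplified]
          V.cochain_zero[OF CklD(1)[OF \<kappa>], where vs = "[]" and us = "[_]", simplified])
    then show "bracket V \<mu> \<beta> = 0 \<and> \<psi>' - \<psi> = bracket V \<alpha> \<beta>" using \<mu>\<beta> d by simp
  next
    assume h: "bracket V \<mu> \<beta> = 0 \<and> \<psi>' - \<psi> = bracket V \<alpha> \<beta>"
    have "\<mu> [(m, 0), \<beta> [v]] = 0" "\<mu> [\<beta> [v], (m, 0)] = 0" for m v
      using pullback(2)[of "(m, 0)" v] pullback(2)[of v "(m, 0)"] h by simp_all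
    then show "\<psi>' - \<psi> = bracket V \<mu> \<beta> + bracket V \<alpha> \<beta> + ?Q" using \<mu>\<beta> h by simp
  qed
qed


section \<open>Low-degree cohomology\<close>

lemma bracket_\<mu>_zero: "bracket V \<mu> 0 = 0" and bracket_\<alpha>_zero: "bracket V \<alpha> 0 = 0"
  by (simp_all only: V.bracket_zero_right cochain \<alpha>_cochain)

lemma Z_mu_zero: "0 \<in> Z_mu M W \<mu> k l"
  by (simp add: Z_mu_def Ckl_zero bracket_\<mu>_zero)

lemma Z_mu_add: "\<phi> \<in> Z_mu M W \<mu> k l \<Longrightarrow> \<chi> \<in> Z_mu M W \<mu> k l \<Longrightarrow> \<phi> + \<chi> \<in> Z_mu M W \<mu> k l"
  by (simp add: Z_mu_def Ckl_add V.bracket_add_right cochain)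

lemma Z_mu_diff: "\<phi> \<in> Z_mu M W \<mu> k l \<Longrightarrow> \<chi> \<in> Z_mu M W \<mu> k l \<Longrightarrow> \<phi> - \<chi> \<in> Z_mu M W \<mu> k l"
  by (simp add: Z_mu_def Ckl_diff V.bracket_diff_right cochain)

text \<open>Equivalences use even \<beta>, whereas the cohomology admits all cocycles. Since \<mu>
  and \<alpha> are odd, taking odd parts of \<open>bracket V \<mu> \<beta> = 0\<close> and
  \<open>\<psi> = bracket V \<alpha> \<beta>\<close> replaces \<beta> by its even part.\<close>

lemma even_coboundary:
  assumes "\<psi> \<in> cochains V" "odd_cochain V \<psi>"
  shows "(\<exists>\<beta>\<in>Ckl M W 0 1. even_cochain V \<beta> \<and> bracket V \<mu> \<beta> = 0 \<and> \<psi> = bracket V \<alpha> \<beta>) \<longleftrightarrow>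
    (\<exists>\<beta>\<in>Z_mu M W \<mu> 0 1. \<psi> = bracket V \<alpha> \<beta>)"
proof
  assume "\<exists>\<beta>\<in>Z_mu M W \<mu> 0 1. \<psi> = bracket V \<alpha> \<beta>"
  then obtain \<beta> where \<beta>: "\<beta> \<in> Ckl M W 0 1" "bracket V \<mu> \<beta> = 0" "\<psi> = bracket V \<alpha> \<beta>"
    by (auto simp: Z_mu_def)
  note \<beta>c = CklD(1)[OF \<beta>(1)]
  have "bracket V \<mu> (hpart V 0 \<beta>) = 0"
    using V.bracket_hpart[OF cochain(2) \<beta>c \<mu>_odd] \<beta>(2) by (simp add: V.hpart_zero)
  moreover have "bracket V \<alpha> (hpart V 0 \<beta>) = \<psi>"
    using V.bracket_hpart[OF \<alpha>_cochain \<beta>c \<alpha>_odd, of 0] V.hpart_homogeneous[OF assms, of 1] \<beta>(3)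
    by simp
  ultimately show "\<exists>\<beta>\<in>Ckl M W 0 1. even_cochain V \<beta> \<and> bracket V \<mu> \<beta> = 0 \<and> \<psi> = bracket V \<alpha> \<beta>"
    using Ckl_hpart[OF \<beta>(1)] V.hpart_parity[OF \<beta>c] by metis
qed (auto simp: Z_mu_def)

lemma rel_mu_0: "rel_mu M W \<mu> 0 l = Id_on (Z_mu M W \<mu> 0 l)"
  by (auto simp: rel_mu_def B_mu_def)

lemma class_mu_0: "class_mu M W \<mu> 0 l \<phi> = (if \<phi> \<in> Z_mu M W \<mu> 0 l then {\<phi>} else {})"
  by (auto simp: class_mu_def rel_mu_0)

lemma H_mu_0: "H_mu M W \<mu> 0 l = (\<lambda>\<phi>. {\<phi>}) ` Z_mu M W \<mu> 0 l"
  by (auto simp: H_mu_def rel_mu_0 quotient_def)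

text \<open>The \<open>else\<close> branch reflects that \<open>class_mu\<close> of a cochain
  outside \<open>Z_mu\<close> is the empty set.\<close>

lemma D_bar_0: "D_bar M W \<mu> \<alpha> 0 l {\<phi>} =
    (if bracket V \<alpha> \<phi> \<in> Z_mu M W \<mu> 0 (Suc l) then {bracket V \<alpha> \<phi>} else {})"
  by (simp add: D_bar_def class_mu_0)

text \<open>These \<psi> satisfy both conditions of \<open>codifferential_iff\<close>, with no
  restriction on parity; the odd ones parametrize the extensions.\<close>

definition cocycles :: "('m \<times> 'w) cochain set" where
  "cocycles = {\<psi> \<in> Z_mu M W \<mu> 0 2. bracket V \<alpha> \<psi> = 0}"

text \<open>The class of zero is \<open>{0}\<close>, so the empty default value of
  \<open>D_bar_0\<close> cannot satisfy the cocycle condition.\<close>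

lemma Z_bar_02: "Z_bar M W \<mu> \<alpha> 0 2 = (\<lambda>\<psi>. {\<psi>}) ` cocycles"
  by (auto simp: Z_bar_def H_mu_0 D_bar_0 class_mu_0 Z_mu_zero cocycles_def split: if_splits)

lemma B_bar_02: "B_bar M W \<mu> \<alpha> 0 2 = D_bar M W \<mu> \<alpha> 0 1 ` H_mu M W \<mu> 0 1"
  by (simp add: B_bar_def numeral_2_eq_2)

lemma rel_bar_02:
  "({\<psi>}, {\<psi>'}) \<in> rel_bar M W \<mu> \<alpha> 0 2 \<longleftrightarrow>
    \<psi> \<in> cocycles \<and> \<psi>' \<in> cocycles \<and> (\<exists>\<beta>\<in>Z_mu M W \<mu> 0 1. \<psi> - \<psi>' = bracket V \<alpha> \<beta>)"
proof -
  have "(\<exists>U\<in>B_bar M W \<mu> \<alpha> 0 2. {\<psi>} = {\<psi>'} + U) \<longleftrightarrow>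
      (\<exists>\<beta>\<in>Z_mu M W \<mu> 0 1. \<psi> - \<psi>' = bracket V \<alpha> \<beta>)"
    if "\<psi> \<in> cocycles" "\<psi>' \<in> cocycles"
  proof -
    have "\<psi> - \<psi>' \<in> Z_mu M W \<mu> 0 2" using that by (simp add: cocycles_def Z_mu_diff)
    moreover have "\<psi> - \<psi>' = \<chi> \<longleftrightarrow> \<psi> = \<psi>' + \<chi>" for \<chi> by (simp only: diff_eq_eq add.commute)
    \<comment> \<open>If \<open>bracket V \<alpha> \<beta>\<close> lies outside \<open>Z_mu\<close>,
      both sides are false: the sum with the empty set is empty, and \<open>\<psi> - \<psi>'\<close>
      does lie in \<open>Z_mu\<close>.\<close>
    ultimately have "{\<psi>} = {\<psi>'} + D_bar M W \<mu> \<alpha> 0 1 {\<beta>} \<longleftrightarrow> \<psi> - \<psi>' = bracket V \<alpha> \<beta>" for \<beta>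
      by (cases "bracket V \<alpha> \<beta> \<in> Z_mu M W \<mu> 0 2")
        (auto simp: D_bar_0 set_plus_def numeral_2_eq_2)
    then show ?thesis by (simp add: B_bar_02 H_mu_0)
  qed
  then show ?thesis by (auto simp: rel_bar_def Z_bar_02)
qed

text \<open>The witnesses for reflexivity, symmetry and transitivity are zero,
  \<open>0 - \<beta>\<close> and \<open>\<beta> + \<beta>'\<close>, by additivity of the bracket
  with \<alpha>.\<close>

lemma equiv_rel_bar_02: "equiv (Z_bar M W \<mu> \<alpha> 0 2) (rel_bar M W \<mu> \<alpha> 0 2)"
proof (rule equivI)
  show "rel_bar M W \<mu> \<alpha> 0 2 \<subseteq> Z_bar M W \<mu> \<alpha> 0 2 \<times> Z_bar M W \<mu> \<alpha> 0 2" by (auto simp: rel_bar_def)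
  have elim: thesis
    if "(X, Y) \<in> rel_bar M W \<mu> \<alpha> 0 2" "\<And>\<psi> \<psi>' \<beta>. X = {\<psi>} \<Longrightarrow> Y = {\<psi>'} \<Longrightarrow> \<psi> \<in> cocycles \<Longrightarrow> \<psi>' \<in> cocycles \<Longrightarrow>
      \<beta> \<in> Z_mu M W \<mu> 0 1 \<Longrightarrow> \<psi> - \<psi>' = bracket V \<alpha> \<beta> \<Longrightarrow> thesis" for X Y thesis
  proof -
    from that(1) obtain \<psi> \<psi>' where XY: "X = {\<psi>}" "Y = {\<psi>'}" by (auto simp: rel_bar_def Z_bar_02)
    with that(1) have "\<psi> \<in> cocycles" "\<psi>' \<in> cocycles"
      "\<exists>\<beta>\<in>Z_mu M W \<mu> 0 1. \<psi> - \<psi>' = bracket V \<alpha> \<beta>" by (simp_all only: rel_bar_02)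
    then show thesis using that(2) XY by blast
  qed
  show "refl_on (Z_bar M W \<mu> \<alpha> 0 2) (rel_bar M W \<mu> \<alpha> 0 2)"
    using Z_mu_zero[of 0 1] bracket_\<alpha>_zero by (force simp: refl_on_def Z_bar_02 rel_bar_02)
  show "sym (rel_bar M W \<mu> \<alpha> 0 2)"
  proof (rule symI, erule elim)
    fix X Y \<psi> \<psi>' \<beta>
    assume h: "X = {\<psi>}" "Y = {\<psi>'}" "\<psi> \<in> cocycles" "\<psi>' \<in> cocycles"
      "\<beta> \<in> Z_mu M W \<mu> 0 1" "\<psi> - \<psi>' = bracket V \<alpha> \<beta>"
    then have "\<psi>' - \<psi> = bracket V \<alpha> (0 - \<beta>)"
      unfolding V.bracket_diff_right[OF \<alpha>_cochain] bracket_\<alpha>_zero by (simp flip: h(6))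
    then show "(Y, X) \<in> rel_bar M W \<mu> \<alpha> 0 2"
      using h Z_mu_diff[OF Z_mu_zero h(5)] unfolding h(1,2) rel_bar_02 by blast
  qed
  show "trans (rel_bar M W \<mu> \<alpha> 0 2)"
  proof (rule transI)
    fix X Y Z assume "(X, Y) \<in> rel_bar M W \<mu> \<alpha> 0 2" "(Y, Z) \<in> rel_bar M W \<mu> \<alpha> 0 2"
    then obtain \<psi> \<psi>' \<psi>'' \<beta> \<beta>' where h: "X = {\<psi>}" "Y = {\<psi>'}" "Z = {\<psi>''}"
      "\<psi> \<in> cocycles" "\<psi>'' \<in> cocycles" "\<beta> \<in> Z_mu M W \<mu> 0 1" "\<beta>' \<in> Z_mu M W \<mu> 0 1"
      "\<psi> - \<psi>' = bracket V \<alpha> \<beta>" "\<psi>' - \<psi>'' = bracket V \<alpha> \<beta>'"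
      by (elim elim) (metis singleton_inject)
    then have "\<psi> - \<psi>'' = bracket V \<alpha> (\<beta> + \<beta>')"
      unfolding V.bracket_add_right[OF \<alpha>_cochain] by (simp flip: h(8,9))
    then show "(X, Z) \<in> rel_bar M W \<mu> \<alpha> 0 2"
      using h Z_mu_add[OF h(6,7)] unfolding h(1-3) rel_bar_02 by blast
  qed
qed

section \<open>Classification of the extensions\<close>

lemma extensions_by_eq:
  "extensions_by M W \<delta> \<mu> \<kappa> = (\<lambda>\<psi>. \<delta> + \<mu> + \<kappa> + \<psi>) ` {\<psi> \<in> cocycles. odd_cochain V \<psi>}"
proof -
  have "d \<in> extensions_by M W \<delta> \<mu> \<kappa> \<longleftrightarrow> (\<exists>\<psi>\<in>Ckl M W 0 2. odd_cochain V \<psi> \<and>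
      d = \<delta> + \<mu> + \<kappa> + \<psi> \<and> bracket V \<mu> \<psi> = 0 \<and> bracket V \<alpha> \<psi> = 0)" for d
    using extensions_by_iff by (auto simp: extensions_by_def)
  then show ?thesis by (auto simp: cocycles_def Z_mu_def)
qed

lemma restricted_equiv_iff:
  assumes \<psi>: "\<psi> \<in> cocycles" "odd_cochain V \<psi>" and \<psi>': "\<psi>' \<in> cocycles" "odd_cochain V \<psi>'"
  shows "(\<delta> + \<mu> + \<kappa> + \<psi>, \<delta> + \<mu> + \<kappa> + \<psi>') \<in> restricted_equiv M W \<delta> \<mu> \<longleftrightarrow>
    ({\<psi>}, {\<psi>'}) \<in> rel_bar M W \<mu> \<alpha> 0 2"
proof -
  have C: "\<psi> \<in> Ckl M W 0 2" "\<psi>' \<in> Ckl M W 0 2" using \<psi>(1) \<psi>'(1) by (auto simp: cocycles_def Z_mu_def)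
  have "\<delta> + \<mu> + \<kappa> + \<psi> \<in> extensions M W \<delta> \<mu>" "\<delta> + \<mu> + \<kappa> + \<psi>' \<in> extensions M W \<delta> \<mu>"
    using extensions_by_eq \<psi> \<psi>' by (auto simp: extensions_by_def)
  then have "(\<delta> + \<mu> + \<kappa> + \<psi>, \<delta> + \<mu> + \<kappa> + \<psi>') \<in> restricted_equiv M W \<delta> \<mu> \<longleftrightarrow>
      (\<exists>\<beta>\<in>Ckl M W 0 1. even_cochain V \<beta> \<and> bracket V \<mu> \<beta> = 0 \<and> \<psi>' - \<psi> = bracket V \<alpha> \<beta>)"
    using pullback_iff[OF C] by (auto simp: restricted_equiv_def)
  also have "\<dots> \<longleftrightarrow> (\<exists>\<beta>\<in>Z_mu M W \<mu> 0 1. \<psi>' - \<psi> = bracket V \<alpha> \<beta>)"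
    using C \<psi> \<psi>' by (intro even_coboundary V.diff_cochain V.has_parity_diff CklD(1))
  also have "\<dots> \<longleftrightarrow> ({\<psi>'}, {\<psi>}) \<in> rel_bar M W \<mu> \<alpha> 0 2"
    using \<psi> \<psi>' by (simp add: rel_bar_02)
  \<comment> \<open>Pulling back yields \<open>\<psi>' - \<psi>\<close>, while
    \<open>rel_bar\<close> compares in the opposite order; symmetry reconciles the two.\<close>
  also have "\<dots> \<longleftrightarrow> ({\<psi>}, {\<psi>'}) \<in> rel_bar M W \<mu> \<alpha> 0 2"
    using equiv_rel_bar_02 by (meson equivE symE)
  finally show ?thesis .
qed

lemma classification:
  fixes A r
  defines "A \<equiv> extensions_by M W \<delta> \<mu> \<kappa>"
  defines "r \<equiv> Restr (restricted_equiv M W \<delta> \<mu>) A"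
  shows "equiv A r \<and>
    (\<exists>\<Phi>. bij_betw \<Phi> (A // r) (H_bar_odd M W \<mu> \<alpha> 0 2) \<and>
      (\<forall>\<psi>\<in>Ckl M W 0 2. odd_cochain V \<psi> \<longrightarrow> \<delta> + \<mu> + \<kappa> + \<psi> \<in> A \<longrightarrow>
        \<Phi> (r `` {\<delta> + \<mu> + \<kappa> + \<psi>}) = class_bar M W \<mu> \<alpha> 0 2 (class_mu M W \<mu> 0 2 \<psi>)))"
proof -
  let ?B = "Z_bar M W \<mu> \<alpha> 0 2" and ?s = "rel_bar M W \<mu> \<alpha> 0 2"
  \<comment> \<open>Subtracting the fixed part recovers \<psi>, and its singleton is its
    \<open>\<mu>\<close>-class.\<close>
  let ?f = "\<lambda>d. {d - (\<delta> + \<mu> + \<kappa>)}"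
  have A: "d \<in> A \<longleftrightarrow> (\<exists>\<psi>. d = \<delta> + \<mu> + \<kappa> + \<psi> \<and> \<psi> \<in> cocycles \<and> odd_cochain V \<psi>)" for d
    unfolding A_def extensions_by_eq by blast
  have f: "?f d \<in> ?B" if "d \<in> A" for d
    using that unfolding A Z_bar_02 by auto
  have iff: "(d, d') \<in> r \<longleftrightarrow> (?f d, ?f d') \<in> ?s" if dd': "d \<in> A" "d' \<in> A" for d d'
  proof -
    obtain \<psi> \<psi>' where "d = \<delta> + \<mu> + \<kappa> + \<psi>" "\<psi> \<in> cocycles" "odd_cochain V \<psi>"
      "d' = \<delta> + \<mu> + \<kappa> + \<psi>'" "\<psi>' \<in> cocycles" "odd_cochain V \<psi>'"
      using dd' unfolding A by blast
    then show ?thesis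
      using dd' restricted_equiv_iff[of \<psi> \<psi>'] unfolding r_def by (simp add: mem_Times_iff)
  qed
  have r: "equiv A r"
    by (rule equiv_pullback[OF equiv_rel_bar_02 f _ iff]) (auto simp: r_def)
  have target: "{c \<in> ?B // ?s. \<exists>d\<in>A. ?f d \<in> c} = H_bar_odd M W \<mu> \<alpha> 0 2"
  proof -
    have "(\<exists>d\<in>A. ?f d \<in> c) \<longleftrightarrow> (\<exists>X\<in>c. \<exists>\<psi>\<in>X. odd_cochain V \<psi>)" if "c \<in> ?B // ?s" for c
    proof
      assume "\<exists>d\<in>A. ?f d \<in> c"
      then obtain d where d: "d \<in> A" "?f d \<in> c" by blast
      then obtain \<psi> where "odd_cochain V \<psi>" "d = \<delta> + \<mu> + \<kappa> + \<psi>" unfolding A by blast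
      with d(2) have "odd_cochain V \<psi>" "{\<psi>} \<in> c" by simp_all
      then show "\<exists>X\<in>c. \<exists>\<psi>\<in>X. odd_cochain V \<psi>" by (intro bexI) simp_all
    next
      assume "\<exists>X\<in>c. \<exists>\<psi>\<in>X. odd_cochain V \<psi>"
      then obtain X \<psi> where X: "X \<in> c" "\<psi> \<in> X" "odd_cochain V \<psi>" by blast
      \<comment> \<open>Members of \<open>c\<close> are singletons of cocycles, so the odd element
        found in \<open>X\<close> is its only one and defines an extension.\<close>
      have "X \<in> ?B" using in_quotient_imp_subset[OF equiv_rel_bar_02 that] X(1) by blast
      then have "X = {\<psi>}" "\<psi> \<in> cocycles" using X(2) unfolding Z_bar_02 by auto
      then have "\<delta> + \<mu> + \<kappa> + \<psi> \<in> A" "?f (\<delta> + \<mu> + \<kappa> + \<psi>) \<in> c"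
        using X unfolding A by auto
      then show "\<exists>d\<in>A. ?f d \<in> c" by blast
    qed
    then show ?thesis unfolding H_bar_odd_def H_bar_def by (intro Collect_cong conj_cong refl)
  qed
  obtain \<Phi> where \<Phi>: "bij_betw \<Phi> (A // r) (H_bar_odd M W \<mu> \<alpha> 0 2)"
    "\<And>d. d \<in> A \<Longrightarrow> \<Phi> (r `` {d}) = ?s `` {?f d}"
    using quotient_bij_betw[OF r equiv_rel_bar_02 f iff] unfolding target by blast
  have "\<Phi> (r `` {\<delta> + \<mu> + \<kappa> + \<psi>}) = class_bar M W \<mu> \<alpha> 0 2 (class_mu M W \<mu> 0 2 \<psi>)"
    if "\<delta> + \<mu> + \<kappa> + \<psi> \<in> A" for \<psi>
  proof -
    have "\<psi> \<in> Z_mu M W \<mu> 0 2" using that by (auto simp: A cocycles_def)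
    then show ?thesis by (simp add: \<Phi>(2)[OF that] class_bar_def class_mu_0)
  qed
  then show ?thesis using r \<Phi>(1) by blast
qed

end

theorem theorem5p1:
  fixes M :: "('k::field, 'm::ab_group_add) graded_space"
    and W :: "('k, 'w::ab_group_add) graded_space"
    and \<delta> \<mu> \<kappa> :: "('m \<times> 'w) cochain"
  assumes "CHAR('k) \<noteq> 2" and "CHAR('k) \<noteq> 3"
    and "graded_vector_space M" and "graded_vector_space W"
    and "\<delta> \<in> CW M W 2" and "odd_cochain (M \<oplus>\<^sub>g W) \<delta>" and "bracket (M \<oplus>\<^sub>g W) \<delta> \<delta> = 0"
    and "\<mu> \<in> Ckl M W 2 0" and "odd_cochain (M \<oplus>\<^sub>g W) \<mu>" and "bracket (M \<oplus>\<^sub>g W) \<mu> \<mu> = 0"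
    and "\<kappa> \<in> Ckl M W 1 1" and "odd_cochain (M \<oplus>\<^sub>g W) \<kappa>"
    and "bracket (M \<oplus>\<^sub>g W) \<delta> \<kappa> + scale_cochain (M \<oplus>\<^sub>g W) (1 / 2) (bracket (M \<oplus>\<^sub>g W) \<kappa> \<kappa>) = 0"
    and "bracket (M \<oplus>\<^sub>g W) \<mu> \<kappa> = 0"
  shows "equiv (extensions_by M W \<delta> \<mu> \<kappa>)
           (Restr (restricted_equiv M W \<delta> \<mu>) (extensions_by M W \<delta> \<mu> \<kappa>)) \<and>
    (\<exists>\<Phi>. bij_betw \<Phi>
           (extensions_by M W \<delta> \<mu> \<kappa> //
              Restr (restricted_equiv M W \<delta> \<mu>) (extensions_by M W \<delta> \<mu> \<kappa>))
           (H_bar_odd M W \<mu> (\<delta> + \<kappa>) 0 2) \<and>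
       (\<forall>\<psi>\<in>Ckl M W 0 2. odd_cochain (M \<oplus>\<^sub>g W) \<psi> \<longrightarrow>
          \<delta> + \<mu> + \<kappa> + \<psi> \<in> extensions_by M W \<delta> \<mu> \<kappa> \<longrightarrow>
          \<Phi> (Restr (restricted_equiv M W \<delta> \<mu>) (extensions_by M W \<delta> \<mu> \<kappa>) ``
               {\<delta> + \<mu> + \<kappa> + \<psi>}) =
          class_bar M W \<mu> (\<delta> + \<kappa>) 0 2 (class_mu M W \<mu> 0 2 \<psi>)))"
proof -
  interpret extension_data M W \<delta> \<mu> \<kappa>
    by (intro extension_data.intro graded_pair.intro extension_data_axioms.intro) (fact assms)+
  show ?thesis by (rule classification)
qed

end
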